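(* Let $\theta$ be a primitive substitution on a finite alphabet $\mathcal{A}$, with $\theta$-matrix $M$ having Perron–Frobenius eigenvalue $\lambda>1$, and let $u$ be a fixed point of $\theta$. Let $f:\mathcal{A}\to\mathbb{R}$ be a left eigenfunction of $M$ with eigenvalue $\lambda_f=1$ which is not a coboundary. Then there are real constants $c_1,c_2$ with $c_2\neq 0$ such that for all $t\in\mathbb{R}$, $$\lim_{N\to\infty}\frac1N\left|\left\{1\le n\le N:\ \frac{S_f(u_{\le n})-c_1\log_\lambda(N)}{c_2\sqrt{\log_\lambda(N)}}\le t\right\}\right|=\int_{-\infty}^t\frac{e^{-x^2/2}}{\sqrt{2\pi}}\,dx.$$
   Context: $\mathcal{A}^*$ is the set of finite words over $\mathcal{A}$. A substitution is a map $\theta:\mathcal{A}\to\mathcal{A}^*$, extended to finite words and to infinite sequences in $\mathcal{A}^{\mathbb{N}}$ by concatenation. The $\theta$-matrix $M$ is the $|\mathcal{A}|\times|\mathcal{A}|$ matrix with $M_{a,b}$ = number of occurrences of $a$ in $\theta(b)$. $\theta$ is primitive if for some $k>0$ all entries of $M^k$ are positive. A fixed point of $\theta$ is a sequence $u=u_1u_2\cdots\in\mathcal{A}^{\mathbb{N}}$ with $\theta^k(u)=u$ for some $k\in\mathbb{N}$. $u_{\le n}=u_1\cdots u_n$. For $f:\mathcal{A}\to\mathbb{C}$ and a word $w=a_1\cdots a_k$, $S_f(w)=f(a_1)+\cdots+f(a_k)$. A left eigenfunction of $M$ with eigenvalue $\lambda_f$ is a nonzero $f$ with $\sum_{a}f(a)M_{a,b}=\lambda_f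 f(b)$ for all $b\in\mathcal{A}$. Here $f$ is called a coboundary if $\{S_f(u_{\le n})\}_{n\ge1}$ is bounded. *)

theory Defs
  imports "HOL-Analysis.Analysis" "HOL-Library.Stream"
begin

text \<open>
  The alphabet is a type \<open>'a :: finite\<close>, a substitution is a map \<open>'a \<Rightarrow> 'a list\<close>, and an infinite
  sequence \<open>u\<^sub>1 u\<^sub>2 \<dots>\<close> is an \<open>'a stream\<close>, so the prefix \<open>u\<^sub>1 \<dots> u\<^sub>n\<close> is \<open>stake n u\<close>.
\<close>

text \<open>
  The stream constant \<^const>\<open>flat\<close> is genuine concatenation only if all words are nonempty. This is the
  case for primitive substitutions: an empty word \<open>\<theta> b\<close> gives a zero column of the matrix
  and hence of all its positive powers.
\<close>

definition subst_seq :: "('a \<Rightarrow> 'a list) \<Rightarrow> 'a stream \<Rightarrow> 'a stream" where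
  "subst_seq \<theta> u = flat (smap \<theta> u)"

definition subst_matrix :: "('a::finite \<Rightarrow> 'a list) \<Rightarrow> real^'a^'a" where
  "subst_matrix \<theta> = (\<chi> a b. real (count_list (\<theta> b) a))"

text \<open>On \<^typ>\<open>real^'a^'a\<close> the product \<open>*\<close> is componentwise, hence the explicit iteration of \<open>**\<close>.\<close>

definition matrix_power :: "real^'a::finite^'a \<Rightarrow> nat \<Rightarrow> real^'a^'a" where
  "matrix_power M k = (((**) M) ^^ k) (mat 1)"

definition primitive_subst :: "('a::finite \<Rightarrow> 'a list) \<Rightarrow> bool" where
  "primitive_subst \<theta> \<longleftrightarrow> (\<exists>k>0. \<forall>a b. matrix_power (subst_matrix \<theta>) k $ a $ b > 0)"

text \<open>The condition \<open>k > 0\<close> is needed: every sequence is fixed by the zeroth iterate.\<close>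

definition fixed_point_subst :: "('a \<Rightarrow> 'a list) \<Rightarrow> 'a stream \<Rightarrow> bool" where
  "fixed_point_subst \<theta> u \<longleftrightarrow> (\<exists>k>0. (subst_seq \<theta> ^^ k) u = u)"

definition matrix_eigenvalue :: "'k::field^'a::finite^'a \<Rightarrow> 'k \<Rightarrow> bool" where
  "matrix_eigenvalue M \<mu> \<longleftrightarrow> (\<exists>v. v \<noteq> 0 \<and> M *v v = \<mu> *s v)"

text \<open>The real eigenvalue whose value is the maximal modulus of all complex eigenvalues.\<close>

definition perron_frobenius_eigenvalue :: "real^'a::finite^'a \<Rightarrow> real \<Rightarrow> bool" where
  "perron_frobenius_eigenvalue M l \<longleftrightarrow>
     matrix_eigenvalue M l \<and>
     (\<forall>\<mu>. matrix_eigenvalue (map_matrix complex_of_real M) \<mu> \<longrightarrow> cmod \<mu> \<le> l)"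

definition word_sum :: "('a \<Rightarrow> real) \<Rightarrow> 'a list \<Rightarrow> real" where
  "word_sum f w = sum_list (map f w)"

definition left_eigenfunction :: "real^'a::finite^'a \<Rightarrow> real \<Rightarrow> ('a \<Rightarrow> real) \<Rightarrow> bool" where
  "left_eigenfunction M l f \<longleftrightarrow>
     (\<exists>a. f a \<noteq> 0) \<and> (\<forall>b. (\<Sum>a\<in>UNIV. f a * M $ a $ b) = l * f b)"

definition coboundary :: "'a stream \<Rightarrow> ('a \<Rightarrow> real) \<Rightarrow> bool" where
  "coboundary u f \<longleftrightarrow> bounded {word_sum f (stake n u) | n. n \<ge> 1}"

end

theory Submission
  imports Defs "HOL-Probability.Probability" "HOL-Real_Asymp.Real_Asymp"
begin

text \<open>
  Pass to an iterate \<open>\<sigma>\<close> of \<open>\<theta>\<close> that fixes \<open>u\<close> and in which every letter occurs in the image of every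
  letter. This changes the base of the logarithm, hence only the two constants. Since
  \<open>f\<close> has eigenvalue 1, a word and its image under \<open>\<sigma>\<close> have the same \<open>f\<close>-sum. Every position \<open>n\<close> of
  \<open>u\<close> lies in the image of exactly one letter of \<open>u\<close>, at the position \<open>parent n\<close>, and so the Birkhoff
  sum at \<open>n\<close> is the Birkhoff sum at \<open>parent n\<close> plus the sum over a proper prefix of
  \<open>\<sigma> a\<close>, where \<open>a\<close> is the letter at \<open>parent n\<close>. After about
  \<open>log N\<close> such steps a position \<open>n < N\<close> has reached 0, so its Birkhoff sum is a sum of about
  \<open>log N\<close> bounded digits. For random \<open>n\<close> the digits are driven by an approximate Markov chain, and the
  statement is a central limit theorem for it.

  The Perron vector \<open>h\<close> (with \<open>word_sum h (\<sigma> a) = \<rho> * h a\<close>) gives the transition probabilities of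
  that chain: inside \<open>\<sigma> a\<close> the letter \<open>b = \<sigma> a ! i\<close> has weight \<open>h b / (\<rho> * h a)\<close>. Adding to the
  Birkhoff sum a function \<open>g\<close> of the current letter and subtracting a drift \<open>m\<close> per step turns the
  digits into martingale differences \<open>d a i\<close> (\<open>martingale_decomposition\<close>). If their asymptotic
  variance \<open>v\<close> were zero, all of them would vanish, then also \<open>m\<close>, and the Birkhoff sums would
  be bounded.

  For the Gaussian limit, the exponential sums over \<open>n < N\<close> of \<open>cis (s * T n)\<close> times a weight of the
  letter at \<open>n\<close> are desubstituted: up to a bounded error, the sum up to \<open>N\<close> with weight \<open>w\<close> equals the
  sum up to \<open>parent N\<close> with the weight obtained from \<open>w\<close> by a perturbed transfer operator
  (\<open>F_desubstitute\<close>). The weight \<open>h - s\<^sup>2 k\<close>, for a suitable \<open>k\<close>, is an eigenvector of this operator up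
  to \<open>O(|s|^3)\<close>, with eigenvalue \<open>\<rho> * exp (- v s\<^sup>2 / 2) * cis (s m)\<close> (\<open>approximate_eigenvector\<close>).
  For \<open>s = t / sqrt (log N)\<close>, iterating \<open>log N - O(1)\<close> times accumulates an error \<open>o(N)\<close> and
  the factor \<open>exp (- v t\<^sup>2 / 2)\<close> (\<open>F_h_asymptotics\<close>). A weight orthogonal to the left
  Perron vector contributes \<open>o(N)\<close> because of a spectral gap (\<open>F_annihilated\<close>), which replaces
  the weight \<open>h\<close> by the constant 1. The continuity theorem for characteristic functions
  finishes the proof.

  Both the function \<open>g\<close> and the correction \<open>k\<close> are solutions of \<open>poisson_equation\<close>, which rests on
  the spectral gap of a positive matrix.
\<close>

section \<open>Iterated substitutions on words and sequences\<close>

definition subst_word :: "('a \<Rightarrow> 'a list) \<Rightarrow> 'a list \<Rightarrow> 'a list" where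
  "subst_word \<theta> w = concat (map \<theta> w)"

lemma subst_word_simps [simp]:
  "subst_word \<theta> [] = []"
  "subst_word \<theta> (a # w) = \<theta> a @ subst_word \<theta> w"
  "subst_word \<theta> (w @ w') = subst_word \<theta> w @ subst_word \<theta> w'"
  by (simp_all add: subst_word_def)

lemma word_sum_simps [simp]:
  "word_sum f [] = 0"
  "word_sum f (a # w) = f a + word_sum f w"
  "word_sum f (w @ w') = word_sum f w + word_sum f w'"
  by (simp_all add: word_sum_def)

lemma word_sum_subst_word:
  "word_sum f (subst_word \<theta> w) = word_sum (\<lambda>a. word_sum f (\<theta> a)) w"
  by (induction w) auto

lemma word_sum_eq_count:
  fixes f :: "'a::finite \<Rightarrow> real"
  shows "word_sum f w = (\<Sum>a\<in>UNIV. real (count_list w a) * f a)"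
proof (induction w)
  case (Cons x w)
  have "(\<Sum>a\<in>UNIV. real (count_list (x # w) a) * f a)
      = (\<Sum>a\<in>UNIV. real (count_list w a) * f a + (if a = x then f a else 0))"
    by (intro sum.cong) (auto simp: algebra_simps)
  also have "\<dots> = word_sum f w + f x"
    by (simp add: sum.distrib Cons.IH)
  finally show ?case by simp
qed simp

lemma word_sum_eq_nth: "word_sum f w = (\<Sum>i<length w. f (w ! i))"
  by (simp add: word_sum_def sum_list_sum_nth atLeast0LessThan)

lemma subst_word_funpow_append:
  "(subst_word \<theta> ^^ n) (w @ w') = (subst_word \<theta> ^^ n) w @ (subst_word \<theta> ^^ n) w'"
  by (induction n) auto

text \<open>An iterate of a substitution is again a substitution.\<close>

lemma subst_word_funpow:
  "(subst_word \<theta> ^^ n) w = subst_word (\<lambda>a. (subst_word \<theta> ^^ n) [a]) w"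
proof (induction w)
  case Nil
  show ?case by (induction n) auto
next
  case (Cons a w)
  then show ?case using subst_word_funpow_append[of n \<theta> "[a]" w] by simp
qed

lemma word_sum_subst_word_funpow:
  assumes "\<And>a. word_sum f (\<theta> a) = f a"
  shows "word_sum f ((subst_word \<theta> ^^ n) w) = word_sum f w"
  by (induction n) (simp_all add: word_sum_subst_word assms)

text \<open>
  The matrix of an iterate is the power of the matrix: this translates primitivity into a
  statement about letters in iterated words.
\<close>

lemma matrix_power_subst_matrix:
  "matrix_power (subst_matrix \<theta>) n $ a $ b = real (count_list ((subst_word \<theta> ^^ n) [b]) a)"
proof (induction n arbitrary: a)
  case 0
  show ?case by (simp add: matrix_power_def mat_def)
next
  case (Suc n)
  have count: "real (count_list v x) = word_sum (\<lambda>c. if c = x then 1 else 0) v" for v :: "'a list" and x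
    by (induction v) auto
  have "matrix_power (subst_matrix \<theta>) (Suc n) $ a $ b
      = (\<Sum>c\<in>UNIV. real (count_list (\<theta> c) a) * matrix_power (subst_matrix \<theta>) n $ c $ b)"
    by (simp add: matrix_power_def matrix_matrix_mult_def subst_matrix_def)
  also have "\<dots> = word_sum (\<lambda>c. real (count_list (\<theta> c) a)) ((subst_word \<theta> ^^ n) [b])"
    unfolding Suc.IH word_sum_eq_count by (simp add: mult.commute)
  also have "\<dots> = real (count_list ((subst_word \<theta> ^^ Suc n) [b]) a)"
    unfolding count by (simp add: word_sum_subst_word)
  finally show ?case .
qed

lemma subst_seq_shift:
  assumes "\<And>a. \<theta> a \<noteq> []"
  shows "subst_seq \<theta> (w @- s) = subst_word \<theta> w @- subst_seq \<theta> s"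
  by (induction w) (auto simp: subst_seq_def assms)

lemma subst_seq_funpow_shift:
  assumes "\<And>a. \<theta> a \<noteq> []"
  shows "(subst_seq \<theta> ^^ n) (w @- s) = (subst_word \<theta> ^^ n) w @- (subst_seq \<theta> ^^ n) s"
  by (induction n) (simp_all add: subst_seq_shift assms)

text \<open>
  The fixed point property in terms of finite prefixes, free of streams of words.
\<close>

lemma stake_subst_seq_funpow_fixed:
  assumes "\<And>a. \<theta> a \<noteq> []" and "(subst_seq \<theta> ^^ n) u = u"
  shows "stake (length ((subst_word \<theta> ^^ n) (stake m u))) u = (subst_word \<theta> ^^ n) (stake m u)"
proof -
  have "u = (subst_seq \<theta> ^^ n) (stake m u @- sdrop m u)"
    by (simp add: stake_sdrop assms(2))
  then have "u = (subst_word \<theta> ^^ n) (stake m u) @- (subst_seq \<theta> ^^ n) (sdrop m u)"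
    by (simp add: subst_seq_funpow_shift assms(1))
  then show ?thesis
    by (metis append.right_neutral diff_self_eq_0 stake.simps(1) stake_shift take_all order_refl)
qed

lemma set_subst_word: "set (subst_word \<theta> w) = (\<Union>a\<in>set w. set (\<theta> a))"
  by (simp add: subst_word_def)

text \<open>
  Once all letters occur in the images under \<open>\<theta>\<^sup>q\<close>, they occur in the images under every multiple of \<open>q\<close>.
  The exponent \<open>q * p\<close> therefore combines positivity with a given period \<open>p\<close> of the fixed point.
\<close>

lemma primitive_subst_positive_power:
  assumes "primitive_subst \<theta>" and "0 < p"
  obtains K where "0 < K" "p dvd K" "\<And>a b. 0 < count_list ((subst_word \<theta> ^^ K) [a]) b"
proof -
  obtain q where q: "0 < q" "\<And>a b. 0 < count_list ((subst_word \<theta> ^^ q) [b]) a"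
    using assms(1) by (auto simp: primitive_subst_def matrix_power_subst_matrix)
  have q_all: "set ((subst_word \<theta> ^^ q) [c]) = UNIV" for c
  proof -
    have "b \<in> set ((subst_word \<theta> ^^ q) [c])" for b
      using q(2)[where a = b and b = c] by (metis count_notin less_irrefl)
    then show ?thesis by auto
  qed
  have all: "set ((subst_word \<theta> ^^ (q * Suc n)) [a]) = UNIV" for n a
  proof (induction n)
    case 0
    show ?case by (simp add: q_all)
  next
    case (Suc n)
    have eq: "(subst_word \<theta> ^^ (q * Suc (Suc n))) [a]
        = subst_word (\<lambda>c. (subst_word \<theta> ^^ q) [c]) ((subst_word \<theta> ^^ (q * Suc n)) [a])"
      by (simp add: funpow_add flip: subst_word_funpow)
    show ?case unfolding eq set_subst_word Suc.IH q_all by simp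
  qed
  show ?thesis
  proof (rule that[of "q * p"])
    show "0 < count_list ((subst_word \<theta> ^^ (q * p)) [a]) b" for a b
    proof -
      have "b \<in> set ((subst_word \<theta> ^^ (q * p)) [a])"
        using all[of "p - 1" a] \<open>0 < p\<close> by simp
      then show ?thesis by (metis count_list_0_iff gr0I)
    qed
  qed (use q \<open>0 < p\<close> in auto)
qed

section \<open>Positive matrices\<close>

text \<open>Brouwer's theorem, applied to the map that \<open>A\<close> induces on the simplex of probability vectors.\<close>

lemma positive_matrix_eigenvector:
  fixes A :: "'a::finite \<Rightarrow> 'a \<Rightarrow> real"
  assumes A: "\<And>a b. 0 < A a b"
  shows "\<exists>\<rho> h. 0 < \<rho> \<and> (\<forall>a. 0 < h a) \<and> (\<forall>a. (\<Sum>b\<in>UNIV. A a b * h b) = \<rho> * h a)"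
proof -
  define S where "S = {x::real^'a. (\<forall>a. 0 \<le> x $ a) \<and> (\<Sum>a\<in>UNIV. x $ a) = 1}"
  define y where "y = (\<lambda>(x::real^'a) a. \<Sum>b\<in>UNIV. A a b * x $ b)"
  define s where "s = (\<lambda>x. \<Sum>a\<in>UNIV. y x a)"
  define F :: "real^'a \<Rightarrow> real^'a" where "F = (\<lambda>x. \<chi> a. y x a / s x)"
  have y_pos: "0 < y x a" if "x \<in> S" for x a
  proof -
    obtain b where "x $ b \<noteq> 0"
      using \<open>x \<in> S\<close> by (force simp: S_def)
    then have "0 < A a b * x $ b"
      using A[of a b] \<open>x \<in> S\<close> by (simp add: S_def less_le)
    then show ?thesis
      unfolding y_def using A \<open>x \<in> S\<close>
      by (intro sum_pos2[of UNIV b]) (auto simp: S_def less_imp_le)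
  qed
  have s_pos: "0 < s x" if "x \<in> S" for x
    unfolding s_def by (intro sum_pos) (auto simp: y_pos that)
  have "bounded S"
  proof (rule boundedI)
    fix x assume "x \<in> S"
    have "norm x \<le> (\<Sum>a\<in>UNIV. \<bar>x $ a\<bar>)" by (rule norm_le_l1_cart)
    also have "\<dots> = 1" using \<open>x \<in> S\<close> by (simp add: S_def)
    finally show "norm x \<le> 1" .
  qed
  moreover have "closed S"
    unfolding S_def
    by (intro closed_Collect_conj closed_Collect_all closed_Collect_le closed_Collect_eq
          continuous_intros)
  ultimately have "compact S" by (simp add: compact_eq_bounded_closed)
  moreover have "convex S"
  proof (rule convexI)
    fix x z :: "real^'a" and p q :: real
    assume *: "x \<in> S" "z \<in> S" "0 \<le> p" "0 \<le> q" "p + q = 1"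
    have "(\<Sum>a\<in>UNIV. (p *\<^sub>R x + q *\<^sub>R z) $ a) = p * (\<Sum>a\<in>UNIV. x $ a) + q * (\<Sum>a\<in>UNIV. z $ a)"
      by (simp add: sum.distrib sum_distrib_left)
    with * show "p *\<^sub>R x + q *\<^sub>R z \<in> S" by (simp add: S_def)
  qed
  moreover have "axis undefined 1 \<in> S"
    by (auto simp: S_def axis_def)
  then have "S \<noteq> {}" by blast
  moreover have "continuous_on S F"
    unfolding F_def s_def y_def
    by (intro continuous_intros) (use s_pos in \<open>force simp: s_def y_def\<close>)
  moreover have "F \<in> S \<rightarrow> S"
  proof
    fix x assume x: "x \<in> S"
    have "(\<Sum>a\<in>UNIV. y x a / s x) = s x / s x"
      unfolding s_def by (rule sum_divide_distrib[symmetric])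
    then show "F x \<in> S"
      using s_pos[OF x] y_pos[OF x] by (simp add: S_def F_def less_imp_le)
  qed
  ultimately obtain x where x: "x \<in> S" "F x = x"
    using brouwer by blast
  have eq: "y x a = s x * x $ a" for a
  proof -
    have "x $ a = y x a / s x" by (subst x(2)[symmetric]) (simp add: F_def)
    with s_pos[OF x(1)] show ?thesis by (simp add: field_simps)
  qed
  have "0 < x $ a" for a
    using eq[of a] y_pos[OF x(1), of a] s_pos[OF x(1)] by (metis zero_less_mult_pos)
  then show ?thesis
    using eq s_pos[OF x(1)] by (intro exI[of _ "s x"] exI[of _ "\<lambda>a. x $ a"]) (auto simp: y_def)
qed

text \<open>
  A positive matrix with its right and left Perron vectors \<open>h\<close> and \<open>r\<close>. In the application \<open>A a b\<close>
  counts the letter \<open>b\<close> in \<open>\<sigma> a\<close>, which is the transpose of the substitution matrix: \<open>h\<close> measures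
  asymptotic lengths and \<open>r\<close> letter frequencies.
\<close>

locale positive_matrix =
  fixes A :: "'a::finite \<Rightarrow> 'a \<Rightarrow> real" and \<rho> :: real and h r :: "'a \<Rightarrow> real"
  assumes A_pos: "0 < A a b"
    and h_pos: "0 < h a"
    and r_pos: "0 < r a"
    and eigen_h: "(\<Sum>b\<in>UNIV. A a b * h b) = \<rho> * h a"
    and eigen_r: "(\<Sum>a\<in>UNIV. r a * A a b) = \<rho> * r b"
begin

definition app :: "('a \<Rightarrow> real) \<Rightarrow> 'a \<Rightarrow> real" where
  "app w a = (\<Sum>b\<in>UNIV. A a b * w b)"

definition pair :: "('a \<Rightarrow> real) \<Rightarrow> real" where
  "pair w = (\<Sum>a\<in>UNIV. r a * w a)"

lemma pair_app: "pair (app w) = \<rho> * pair w"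
proof -
  have "pair (app w) = (\<Sum>a\<in>UNIV. \<Sum>b\<in>UNIV. r a * A a b * w b)"
    by (simp add: pair_def app_def sum_distrib_left mult.assoc)
  also have "\<dots> = (\<Sum>b\<in>UNIV. (\<Sum>a\<in>UNIV. r a * A a b) * w b)"
    by (subst sum.swap) (simp add: sum_distrib_right)
  finally show ?thesis
    by (simp add: eigen_r pair_def sum_distrib_left mult.assoc)
qed

lemma pair_linear:
  "pair (\<lambda>a. v a + w a) = pair v + pair w"
  "pair (\<lambda>a. v a - w a) = pair v - pair w"
  "pair (\<lambda>a. c * w a) = c * pair w"
  by (simp_all add: pair_def distrib_left right_diff_distrib sum.distrib sum_subtractf
      sum_distrib_left mult_ac)

lemma app_linear:
  "app (\<lambda>a. v a + w a) b = app v b + app w b"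
  "app (\<lambda>a. c * w a) b = c * app w b"
  by (simp_all add: app_def distrib_left sum.distrib sum_distrib_left mult_ac)

lemma pair_mono: "(\<And>a. v a \<le> w a) \<Longrightarrow> pair v \<le> pair w"
  unfolding pair_def by (intro sum_mono mult_left_mono) (auto simp: r_pos less_imp_le)

lemma pair_pos:
  assumes "\<And>a. 0 \<le> w a" and "0 < w b"
  shows "0 < pair w"
  unfolding pair_def by (rule sum_pos2[of UNIV b]) (auto simp: assms r_pos less_imp_le)

lemma pair_h_pos: "0 < pair h"
  by (rule pair_pos[of _ undefined]) (auto simp: h_pos less_imp_le)

lemma app_h: "app h a = \<rho> * h a"
  by (simp add: app_def eigen_h)

lemma rho_pos: "0 < \<rho>"
proof -
  have "0 < \<rho> * h undefined"
    unfolding eigen_h[symmetric] by (intro sum_pos) (auto simp: A_pos h_pos)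
  then show ?thesis using h_pos[of undefined] by (simp add: zero_less_mult_iff)
qed

text \<open>
  Removing from \<open>A\<close> a small multiple of the rank one matrix \<open>h a * r b\<close> leaves a nonnegative
  matrix whose eigenvalue for \<open>r\<close> is smaller than \<open>\<rho>\<close>, and the removed part vanishes on
  the annihilator of \<open>r\<close>.
\<close>

lemma spectral_gap:
  obtains q where "0 \<le> q" "q < 1"
    "\<And>w. pair w = 0 \<Longrightarrow> pair (\<lambda>a. \<bar>app w a\<bar>) \<le> q * \<rho> * pair (\<lambda>a. \<bar>w a\<bar>)"
proof -
  define \<delta> where "\<delta> = Min (range (\<lambda>(a, b). A a b / (h a * r b)))"
  have "\<delta> > 0"
    unfolding \<delta>_def by (subst Min_gr_iff) (auto simp: A_pos h_pos r_pos)
  have le: "\<delta> * h a * r b \<le> A a b" for a b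
  proof -
    have "\<delta> \<le> A a b / (h a * r b)"
      unfolding \<delta>_def by (intro Min_le) (auto intro: range_eqI[of _ _ "(a, b)"])
    then show ?thesis
      using h_pos[of a] r_pos[of b] by (simp add: pos_le_divide_eq mult.assoc)
  qed
  have \<delta>_le: "\<delta> * pair h \<le> \<rho>"
  proof -
    have "\<delta> * pair h * r undefined = (\<Sum>a\<in>UNIV. r a * (\<delta> * h a * r undefined))"
      by (simp add: pair_def sum_distrib_left sum_distrib_right mult_ac)
    also have "\<dots> \<le> (\<Sum>a\<in>UNIV. r a * A a undefined)"
      by (intro sum_mono mult_left_mono le) (auto simp: r_pos less_imp_le)
    finally show ?thesis using r_pos[of undefined] by (simp add: eigen_r)
  qed
  have bound: "pair (\<lambda>a. \<bar>app w a\<bar>) \<le> (\<rho> - \<delta> * pair h) * pair (\<lambda>a. \<bar>w a\<bar>)" if "pair w = 0" for w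
  proof -
    have *: "\<bar>app w a\<bar> \<le> app (\<lambda>b. \<bar>w b\<bar>) a - \<delta> * h a * pair (\<lambda>b. \<bar>w b\<bar>)" for a
    proof -
      have "app w a = app w a - \<delta> * h a * pair w" by (simp add: that)
      also have "\<dots> = (\<Sum>b\<in>UNIV. (A a b - \<delta> * h a * r b) * w b)"
        by (simp add: app_def pair_def left_diff_distrib sum_subtractf sum_distrib_left mult.assoc)
      also have "\<bar>\<dots>\<bar> \<le> (\<Sum>b\<in>UNIV. \<bar>(A a b - \<delta> * h a * r b) * w b\<bar>)" by (rule sum_abs)
      also have "\<dots> = (\<Sum>b\<in>UNIV. (A a b - \<delta> * h a * r b) * \<bar>w b\<bar>)"
        using le by (simp add: abs_mult)
      also have "\<dots> = app (\<lambda>b. \<bar>w b\<bar>) a - \<delta> * h a * pair (\<lambda>b. \<bar>w b\<bar>)"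
        by (simp add: app_def pair_def left_diff_distrib sum_subtractf sum_distrib_left mult.assoc)
      finally show ?thesis .
    qed
    have "pair (\<lambda>a. \<bar>app w a\<bar>) \<le> pair (\<lambda>a. app (\<lambda>b. \<bar>w b\<bar>) a - \<delta> * h a * pair (\<lambda>b. \<bar>w b\<bar>))"
      by (rule pair_mono) (rule *)
    also have "\<dots> = pair (app (\<lambda>b. \<bar>w b\<bar>)) - \<delta> * pair h * pair (\<lambda>b. \<bar>w b\<bar>)"
      using pair_linear(3)[of "\<delta> * pair (\<lambda>b. \<bar>w b\<bar>)" h] by (simp add: pair_linear(2) mult_ac)
    finally show ?thesis by (simp add: pair_app algebra_simps)
  qed
  show ?thesis
  proof (rule that[of "1 - \<delta> * pair h / \<rho>"])
    show "pair (\<lambda>a. \<bar>app w a\<bar>) \<le> (1 - \<delta> * pair h / \<rho>) * \<rho> * pair (\<lambda>a. \<bar>w a\<bar>)"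
      if "pair w = 0" for w
      using bound[OF that] rho_pos by (simp add: left_diff_distrib)
  qed (use \<delta>_le \<open>\<delta> > 0\<close> pair_h_pos rho_pos in \<open>auto simp: divide_simps\<close>)
qed

text \<open>
  The spectral gap makes \<open>x \<mapsto> A x - \<rho> x + \<langle>r, x\<rangle> h\<close> injective, hence surjective.
  So \<open>A - \<rho>\<close> reaches every vector up to a multiple of \<open>h\<close>, and pairing with \<open>r\<close> determines
  the multiple.
\<close>

lemma poisson_equation:
  obtains x where "\<And>a. app x a - \<rho> * x a = pair w / pair h * h a - w a"
proof -
  obtain q where q: "0 \<le> q" "q < 1"
    "\<And>w. pair w = 0 \<Longrightarrow> pair (\<lambda>a. \<bar>app w a\<bar>) \<le> q * \<rho> * pair (\<lambda>a. \<bar>w a\<bar>)"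
    using spectral_gap by blast
  define T :: "real^'a \<Rightarrow> real^'a" where
    "T x = (\<chi> a. app (\<lambda>b. x $ b) a - \<rho> * x $ a + pair (\<lambda>b. x $ b) * h a)" for x
  have pair_T: "pair (\<lambda>a. T x $ a) = pair (\<lambda>b. x $ b) * pair h" for x
    using pair_linear(3)[of "pair (\<lambda>b. x $ b)" h]
    by (simp add: T_def pair_linear pair_app)
  have "linear T"
    by (rule linearI) (simp_all add: T_def vec_eq_iff app_linear pair_linear algebra_simps)
  moreover have "inj T"
  proof (subst linear_injective_0[OF \<open>linear T\<close>], intro allI impI)
    fix x assume "T x = 0"
    then have "pair (\<lambda>b. x $ b) = 0"
      using pair_T[of x] pair_h_pos by (simp add: pair_def)
    have "app (\<lambda>b. x $ b) a = \<rho> * x $ a" for a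
      using arg_cong[OF \<open>T x = 0\<close>, of "\<lambda>v. v $ a"] by (simp add: T_def \<open>pair _ = 0\<close>)
    then have "pair (\<lambda>a. \<rho> * \<bar>x $ a\<bar>) \<le> q * \<rho> * pair (\<lambda>a. \<bar>x $ a\<bar>)"
      using q(3)[OF \<open>pair (\<lambda>b. x $ b) = 0\<close>] rho_pos by (simp add: abs_mult)
    moreover have "pair (\<lambda>a. \<rho> * \<bar>x $ a\<bar>) = \<rho> * pair (\<lambda>a. \<bar>x $ a\<bar>)"
      by (rule pair_linear)
    ultimately have "\<not> 0 < pair (\<lambda>a. \<bar>x $ a\<bar>)"
      using q(2) rho_pos by (auto simp: mult_less_cancel_right2 not_le mult.assoc)
    then have "\<bar>x $ a\<bar> = 0" for a
      using pair_pos[of "\<lambda>a. \<bar>x $ a\<bar>" a] by force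
    then show "x = 0" by (simp add: vec_eq_iff)
  qed
  ultimately have "surj T" using linear_injective_imp_surjective[of T] by simp
  define c where "c = pair w / pair h"
  obtain x where x: "T x = (\<chi> a. c * h a - w a)"
    using \<open>surj T\<close> by (metis surjD)
  have "pair (\<lambda>b. x $ b) * pair h = pair (\<lambda>a. c * h a - w a)"
    unfolding pair_T[symmetric] by (rule arg_cong[of _ _ pair]) (simp add: x fun_eq_iff)
  also have "\<dots> = c * pair h - pair w" by (simp add: pair_linear)
  also have "\<dots> = 0" using pair_h_pos by (simp add: c_def)
  finally have 0: "pair (\<lambda>b. x $ b) = 0" using pair_h_pos by simp
  show ?thesis
  proof (rule that[of "\<lambda>b. x $ b"])
    show "app (\<lambda>b. x $ b) a - \<rho> * x $ a = pair w / pair h * h a - w a" for a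
      using arg_cong[OF x, of "\<lambda>v. v $ a"] by (simp add: T_def 0 c_def)
  qed
qed

text \<open>
  The contraction factor \<open>q < 1\<close> of the spectral gap acts at every step, since the annihilator of \<open>r\<close> is
  invariant.
\<close>

lemma app_funpow_tendsto_zero:
  assumes "pair w = 0"
  shows "(\<lambda>n. pair (\<lambda>a. \<bar>(app ^^ n) w a\<bar>) / \<rho> ^ n) \<longlonglongrightarrow> 0"
proof -
  obtain q where q: "0 \<le> q" "q < 1"
    "\<And>w. pair w = 0 \<Longrightarrow> pair (\<lambda>a. \<bar>app w a\<bar>) \<le> q * \<rho> * pair (\<lambda>a. \<bar>w a\<bar>)"
    using spectral_gap by blast
  have 0: "pair ((app ^^ n) w) = 0" for n
    by (induction n) (simp_all add: assms pair_app)
  have "pair (\<lambda>a. \<bar>(app ^^ n) w a\<bar>) \<le> (q * \<rho>) ^ n * pair (\<lambda>a. \<bar>w a\<bar>)" for n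
  proof (induction n)
    case (Suc n)
    have "pair (\<lambda>a. \<bar>(app ^^ Suc n) w a\<bar>) \<le> q * \<rho> * pair (\<lambda>a. \<bar>(app ^^ n) w a\<bar>)"
      using q(3)[OF 0[of n]] by simp
    also have "\<dots> \<le> q * \<rho> * ((q * \<rho>) ^ n * pair (\<lambda>a. \<bar>w a\<bar>))"
      using Suc.IH q(1) rho_pos by (intro mult_left_mono) auto
    finally show ?case by (simp add: mult_ac)
  qed simp
  then have upper: "pair (\<lambda>a. \<bar>(app ^^ n) w a\<bar>) / \<rho> ^ n \<le> q ^ n * pair (\<lambda>a. \<bar>w a\<bar>)" for n
    using rho_pos by (simp add: divide_le_eq power_mult_distrib mult_ac)
  have lower: "0 \<le> pair (\<lambda>a. \<bar>(app ^^ n) w a\<bar>) / \<rho> ^ n" for n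
    using rho_pos pair_mono[of "\<lambda>_. 0"] by (simp add: pair_def)
  have lim: "(\<lambda>n. q ^ n * pair (\<lambda>a. \<bar>w a\<bar>)) \<longlonglongrightarrow> 0"
    using q(1,2) by (intro tendsto_mult_left_zero LIMSEQ_power_zero) auto
  show ?thesis
    by (rule real_tendsto_sandwich[OF _ _ tendsto_const lim]) (simp_all add: lower upper)
qed

end

text \<open>
  Pairing the entrywise bound \<open>l * \<bar>x\<bar> \<le> \<bar>x\<bar> A\<close> with the positive vector \<open>h\<close> compares \<open>l\<close> with \<open>\<rho>\<close>.
\<close>

lemma (in positive_matrix) eigenvalue_le_rho:
  assumes "x c \<noteq> 0" and x: "\<And>b. (\<Sum>a\<in>UNIV. A a b * x a) = l * x b"
  shows "l \<le> \<rho>"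
proof -
  define H where "H = (\<Sum>a\<in>UNIV. h a * \<bar>x a\<bar>)"
  have "0 < H"
    unfolding H_def using assms(1) by (intro sum_pos2[of UNIV c]) (auto simp: h_pos less_imp_le)
  have "l * H \<le> (\<Sum>b\<in>UNIV. h b * \<bar>l * x b\<bar>)"
    unfolding H_def sum_distrib_left
    by (intro sum_mono) (simp add: abs_mult mult.left_commute mult_left_mono mult_right_mono h_pos less_imp_le)
  also have "\<dots> \<le> (\<Sum>b\<in>UNIV. h b * (\<Sum>a\<in>UNIV. A a b * \<bar>x a\<bar>))"
  proof (intro sum_mono mult_left_mono)
    show "\<bar>l * x b\<bar> \<le> (\<Sum>a\<in>UNIV. A a b * \<bar>x a\<bar>)" for b
      using sum_abs[of "\<lambda>a. A a b * x a" UNIV] A_pos by (simp add: x abs_mult less_imp_le)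
  qed (auto simp: h_pos less_imp_le)
  also have "\<dots> = (\<Sum>a\<in>UNIV. \<Sum>b\<in>UNIV. A a b * h b * \<bar>x a\<bar>)"
    unfolding sum_distrib_left by (subst sum.swap) (simp add: mult_ac)
  also have "\<dots> = \<rho> * H"
    by (simp only: sum_distrib_right[symmetric] eigen_h) (simp add: H_def sum_distrib_left mult_ac)
  finally show ?thesis using \<open>0 < H\<close> by simp
qed

text \<open>
  The eigenvalues of the positive eigenvectors of \<open>A\<close> and of its transpose agree because the two
  vectors have a positive inner product.
\<close>

lemma positive_matrix_exists:
  fixes A :: "'a::finite \<Rightarrow> 'a \<Rightarrow> real"
  assumes A: "\<And>a b. 0 < A a b"
  obtains \<rho> h r where "positive_matrix A \<rho> h r"
proof -
  obtain \<rho> h where h: "0 < \<rho>" "\<And>a. 0 < h a" "\<And>a. (\<Sum>b\<in>UNIV. A a b * h b) = \<rho> * h a"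
    using positive_matrix_eigenvector[of A] A by blast
  obtain \<rho>' r where r: "0 < \<rho>'" "\<And>a. 0 < r a" "\<And>b. (\<Sum>a\<in>UNIV. A a b * r a) = \<rho>' * r b"
    using positive_matrix_eigenvector[of "\<lambda>b a. A a b"] A by blast
  have "\<rho> * (\<Sum>a\<in>UNIV. r a * h a) = (\<Sum>a\<in>UNIV. r a * (\<Sum>b\<in>UNIV. A a b * h b))"
    by (simp add: h(3) sum_distrib_left mult.left_commute)
  also have "\<dots> = (\<Sum>a\<in>UNIV. \<Sum>b\<in>UNIV. r a * (A a b * h b))"
    by (simp only: sum_distrib_left)
  also have "\<dots> = (\<Sum>b\<in>UNIV. h b * (\<Sum>a\<in>UNIV. A a b * r a))"
    by (subst sum.swap) (simp add: sum_distrib_left mult_ac)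
  also have "\<dots> = \<rho>' * (\<Sum>a\<in>UNIV. r a * h a)"
    by (simp only: r(3)) (simp add: sum_distrib_left mult_ac)
  finally have "\<rho> * (\<Sum>a\<in>UNIV. r a * h a) = \<rho>' * (\<Sum>a\<in>UNIV. r a * h a)" .
  moreover have "0 < (\<Sum>a\<in>UNIV. r a * h a)"
    by (intro sum_pos) (auto simp: h(2) r(2))
  ultimately have "\<rho>' = \<rho>" by simp
  then have "positive_matrix A \<rho> h r"
    using A h r by unfold_locales (simp_all add: mult.commute)
  then show ?thesis by (rule that)
qed

lemma matrix_power_eigenvector:
  fixes M :: "real^'a::finite^'a"
  assumes "M *v x = l *s x"
  shows "matrix_power M n *v x = l ^ n *s x"
proof (induction n)
  case (Suc n)
  have "matrix_power M (Suc n) *v x = M *v (matrix_power M n *v x)"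
    by (simp add: matrix_power_def matrix_vector_mul_assoc)
  also have "\<dots> = l ^ Suc n *s x"
    by (simp add: Suc.IH assms vector_scalar_commute mult.commute)
  finally show ?case .
qed (simp add: matrix_power_def)

section \<open>Desubstitution of a fixed point\<close>

lemma sum_lessThan_add:
  fixes G :: "nat \<Rightarrow> 'b::comm_monoid_add"
  shows "(\<Sum>n<a + b. G n) = (\<Sum>n<a. G n) + (\<Sum>i<b. G (a + i))"
  by (induction b) (simp_all add: add.assoc)

locale substitution_fixed_point =
  positive_matrix "\<lambda>a b. real (count_list (\<sigma> a) b)" \<rho> h r
  for \<sigma> :: "'a::finite \<Rightarrow> 'a list" and \<rho> h r +
  fixes u :: "'a stream"
  assumes fixed: "stake (length (subst_word \<sigma> (stake m u))) u = subst_word \<sigma> (stake m u)"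
    and rho_gt_1: "1 < \<rho>"
begin

text \<open>
  Positions are counted from 0. The image of the letter at position \<open>j\<close> occupies in \<open>u\<close> the positions
  from \<open>image_len j\<close> up to, but excluding, \<open>image_len (Suc j)\<close>, and \<open>parent N\<close> is the \<open>j\<close> whose block contains \<open>N\<close>.
\<close>

definition image_len :: "nat \<Rightarrow> nat" where
  "image_len m = length (subst_word \<sigma> (stake m u))"

definition parent :: "nat \<Rightarrow> nat" where
  "parent N = (LEAST m. N < image_len (Suc m))"

definition max_len :: nat where
  "max_len = (\<Sum>a\<in>UNIV. length (\<sigma> a))"

lemma length_le_max_len: "length (\<sigma> a) \<le> max_len"
  unfolding max_len_def by (rule member_le_sum) auto

lemma app_eq_nth: "app w a = (\<Sum>i<length (\<sigma> a). w (\<sigma> a ! i))"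
  by (simp add: app_def word_sum_eq_count[symmetric] word_sum_eq_nth)

lemma length_pos: "0 < length (\<sigma> a)"
  using A_pos[of a a] by (cases "\<sigma> a") auto

lemma image_len_0 [simp]: "image_len 0 = 0"
  by (simp add: image_len_def)

lemma image_len_Suc: "image_len (Suc m) = image_len m + length (\<sigma> (u !! m))"
  by (simp add: image_len_def stake_Suc del: stake.simps)

lemma le_image_len: "m \<le> image_len m"
proof (induction m)
  case (Suc m)
  then show ?case using length_pos[of "u !! m"] unfolding image_len_Suc by linarith
qed simp

lemma stake_image_len:
  assumes "i \<le> length (\<sigma> (u !! j))"
  shows "stake (image_len j + i) u = subst_word \<sigma> (stake j u) @ take i (\<sigma> (u !! j))"
proof -
  have "stake (image_len j + i) u = take (image_len j + i) (stake (image_len (Suc j)) u)"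
    using assms by (simp add: take_stake image_len_Suc min_def)
  also have "stake (image_len (Suc j)) u = subst_word \<sigma> (stake j u) @ \<sigma> (u !! j)"
    unfolding image_len_def fixed by (simp add: stake_Suc del: stake.simps)
  finally show ?thesis by (simp add: image_len_def)
qed

lemma snth_image_len:
  assumes "i < length (\<sigma> (u !! j))"
  shows "u !! (image_len j + i) = \<sigma> (u !! j) ! i"
proof -
  have "u !! (image_len j + i) = stake (image_len j + Suc i) u ! (image_len j + i)"
    by (rule stake_nth[symmetric]) simp
  also have "\<dots> = \<sigma> (u !! j) ! i"
    using assms stake_image_len[of "Suc i" j] by (simp add: image_len_def nth_append)
  finally show ?thesis .
qed

lemma sum_image_len:
  fixes G :: "nat \<Rightarrow> 'b::comm_monoid_add"
  shows "(\<Sum>n<image_len m. G n) = (\<Sum>j<m. \<Sum>i<length (\<sigma> (u !! j)). G (image_len j + i))"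
  by (induction m) (simp_all add: image_len_Suc sum_lessThan_add)

lemma image_len_parent_le: "image_len (parent N) \<le> N"
  and less_image_len_Suc_parent: "N < image_len (Suc (parent N))"
proof -
  have "N < image_len (Suc N)" using le_image_len[of "Suc N"] by simp
  then show "N < image_len (Suc (parent N))" unfolding parent_def by (rule LeastI)
  show "image_len (parent N) \<le> N"
  proof (cases "parent N")
    case (Suc p)
    then have "\<not> N < image_len (Suc p)" unfolding parent_def by (intro not_less_Least) simp
    then show ?thesis by (simp add: Suc)
  qed simp
qed

lemma parent_le: "parent N \<le> N"
  using image_len_parent_le[of N] le_image_len[of "parent N"] by simp

lemma obtain_parent:
  obtains i where "i < length (\<sigma> (u !! parent N))" "N = image_len (parent N) + i"
  using image_len_parent_le[of N] less_image_len_Suc_parent[of N] that[of "N - image_len (parent N)"] by (simp add: image_len_Suc)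

text \<open>
  Unlike the number of letters, the length weighted by \<open>h\<close> is multiplied by exactly \<open>\<rho>\<close> under \<open>\<sigma>\<close>. It
  therefore controls how fast iterated parents decrease.
\<close>

definition perron_len :: "nat \<Rightarrow> real" where
  "perron_len N = (\<Sum>n<N. h (u !! n))"

lemma perron_len_image_len: "perron_len (image_len m) = \<rho> * perron_len m"
proof -
  have "perron_len (image_len m) = (\<Sum>j<m. \<Sum>i<length (\<sigma> (u !! j)). h (\<sigma> (u !! j) ! i))"
    unfolding perron_len_def sum_image_len by (intro sum.cong refl arg_cong[of _ _ h]) (simp add: snth_image_len)
  also have "\<dots> = (\<Sum>j<m. \<rho> * h (u !! j))"
    by (simp add: app_eq_nth[symmetric] app_h)
  finally show ?thesis by (simp add: perron_len_def sum_distrib_left)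
qed

lemma perron_len_mono: "m \<le> n \<Longrightarrow> perron_len m \<le> perron_len n"
  unfolding perron_len_def by (intro sum_mono2) (auto simp: h_pos less_imp_le)

lemma perron_len_nonneg: "0 \<le> perron_len n"
  using perron_len_mono[of 0 n] by (simp add: perron_len_def)

lemma perron_len_parent_funpow: "perron_len ((parent ^^ j) N) \<le> perron_len N / \<rho> ^ j"
proof (induction j)
  case (Suc j)
  let ?P = "(parent ^^ j) N"
  have "\<rho> * perron_len (parent ?P) \<le> perron_len ?P"
    unfolding perron_len_image_len[symmetric] by (rule perron_len_mono[OF image_len_parent_le])
  then have "\<rho> * perron_len (parent ?P) \<le> perron_len N / \<rho> ^ j"
    using Suc.IH by simp
  then show ?case using rho_pos by (simp add: field_simps)
qed simp

lemma perron_len_comparable: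
  obtains C where "0 < C" "\<And>n. real n \<le> C * perron_len n" "\<And>n. perron_len n \<le> C * real n"
proof -
  define lo where "lo = Min (range h)"
  define C where "C = max (1 / lo) (\<Sum>a\<in>UNIV. h a)"
  have lo: "0 < lo" "lo \<le> h a" for a
    unfolding lo_def by (auto simp: h_pos)
  have "0 < C" using lo(1) by (simp add: C_def less_max_iff_disj)
  moreover have "real n \<le> C * perron_len n" for n
  proof -
    have "real n * lo \<le> perron_len n"
      unfolding perron_len_def using sum_mono[of "{..<n}" "\<lambda>_. lo" "\<lambda>n. h (u !! n)"] lo(2) by simp
    then have "real n \<le> 1 / lo * perron_len n" using lo(1) by (simp add: field_simps)
    also have "\<dots> \<le> C * perron_len n"
      using perron_len_nonneg by (intro mult_right_mono) (auto simp: C_def)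
    finally show ?thesis .
  qed
  moreover have "perron_len n \<le> C * real n" for n
  proof -
    have "h a \<le> C" for a
      unfolding C_def by (rule max.coboundedI2, rule member_le_sum) (auto simp: h_pos less_imp_le)
    then show ?thesis
      unfolding perron_len_def using sum_mono[of "{..<n}" "\<lambda>n. h (u !! n)" "\<lambda>_. C"] by (simp add: mult.commute)
  qed
  ultimately show ?thesis by (rule that)
qed

lemma parent_funpow_le:
  obtains C where "0 < C" "\<And>j N. real ((parent ^^ j) N) \<le> C * real N / \<rho> ^ j"
proof -
  obtain C where C: "0 < C" "\<And>n. real n \<le> C * perron_len n" "\<And>n. perron_len n \<le> C * real n"
    using perron_len_comparable by blast
  have "real ((parent ^^ j) N) \<le> C * C * real N / \<rho> ^ j" for j N
  proof -
    have "real ((parent ^^ j) N) \<le> C * perron_len ((parent ^^ j) N)" by (rule C)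
    also have "\<dots> \<le> C * (perron_len N / \<rho> ^ j)"
      using C(1) perron_len_parent_funpow by (intro mult_left_mono) auto
    also have "\<dots> \<le> C * (C * real N / \<rho> ^ j)"
      using C rho_pos by (intro mult_left_mono divide_right_mono) auto
    finally show ?thesis by (simp add: mult.assoc)
  qed
  then show ?thesis using C(1) by (intro that[of "C * C"]) auto
qed

lemma parent_less:
  assumes "0 < N"
  shows "parent N < N"
proof -
  have "perron_len (parent N) < perron_len N"
  proof -
    have "0 < perron_len N"
      unfolding perron_len_def using assms by (intro sum_pos) (auto simp: h_pos)
    moreover have "\<rho> * perron_len (parent N) \<le> perron_len N"
      unfolding perron_len_image_len[symmetric] by (rule perron_len_mono[OF image_len_parent_le])
    moreover have "perron_len (parent N) \<le> \<rho> * perron_len (parent N) "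
      using rho_gt_1 perron_len_nonneg[of "parent N"] by (simp add: mult_le_cancel_right1)
    moreover have "0 < perron_len (parent N) \<Longrightarrow> perron_len (parent N) < \<rho> * perron_len (parent N) "
      using rho_gt_1 by simp
    ultimately show ?thesis using perron_len_nonneg[of "parent N"] by linarith
  qed
  then show ?thesis using perron_len_mono[of N "parent N"] by linarith
qed

end

section \<open>Twisted sums and the perturbed transfer operator\<close>

lemma cis_approx1: "cmod (cis x - 1) \<le> \<bar>x\<bar>"
  using iexp_approx1[of x 0] by (simp add: cis_conv_exp)

lemma cis_approx3: "cmod (cis x - (1 + \<i> * x - x\<^sup>2 / 2)) \<le> \<bar>x\<bar> ^ 3"
proof -
  have "cmod (cis x - (1 + \<i> * x - x\<^sup>2 / 2)) \<le> \<bar>x\<bar> ^ 3 / fact 3"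
    using iexp_approx1[of x 2]
    by (simp add: cis_conv_exp numeral_2_eq_2 numeral_3_eq_3 power_mult_distrib)
  also have "\<dots> \<le> \<bar>x\<bar> ^ 3" by (simp add: fact_numeral)
  finally show ?thesis .
qed

lemma exp_minus_approx:
  fixes y :: real
  assumes "0 \<le> y"
  shows "\<bar>exp (- y) - 1\<bar> \<le> y" "\<bar>exp (- y) - (1 - y)\<bar> \<le> y\<^sup>2"
proof -
  have lo: "1 - y \<le> exp (- y)" using exp_ge_add_one_self[of "- y"] by simp
  moreover have "exp (- y) \<le> 1" using assms by simp
  ultimately show "\<bar>exp (- y) - 1\<bar> \<le> y" by simp
  have "exp (- y) \<le> 1 / (1 + y)"
    using exp_ge_add_one_self[of y] assms by (simp add: exp_minus inverse_eq_divide frac_le)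
  also have "\<dots> \<le> 1 - y + y\<^sup>2"
  proof -
    have "(1 - y + y\<^sup>2) * (1 + y) = 1 + y ^ 3"
      by (simp add: algebra_simps power2_eq_square power3_eq_cube)
    then show ?thesis using assms by (simp add: pos_divide_le_eq)
  qed
  finally show "\<bar>exp (- y) - (1 - y)\<bar> \<le> y\<^sup>2" using lo by simp
qed

text \<open>
  A function \<open>T\<close> of the position that changes from \<open>parent n\<close> to \<open>n\<close> by a drift \<open>m\<close> and a digit \<open>d a i\<close>
  depending on the letter \<open>a\<close> at \<open>parent n\<close> and the place \<open>i\<close> of \<open>n\<close> in its block. The condition
  \<open>mean_zero\<close> says that the digits have conditional mean zero for the transition probabilities
  \<open>h (\<sigma> a ! i) / (\<rho> * h a)\<close>. The equation for \<open>k\<close> expresses that the conditional variance of the digits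
  has mean \<open>v\<close>: it equals \<open>v\<close> up to a coboundary of the chain, given by \<open>k\<close>. It is also the equation
  which the second order perturbation of the eigenvector \<open>h\<close> has to satisfy.
\<close>

locale martingale_cocycle = substitution_fixed_point +
  fixes T :: "nat \<Rightarrow> real" and d :: "'a \<Rightarrow> nat \<Rightarrow> real" and m v :: real and k :: "'a \<Rightarrow> real"
  assumes step: "i < length (\<sigma> (u !! j)) \<Longrightarrow> T (image_len j + i) = T j + m + d (u !! j) i"
    and mean_zero: "(\<Sum>i<length (\<sigma> a). d a i * h (\<sigma> a ! i)) = 0"
    and variance: "app k a - \<rho> * k a =
      \<rho> * v / 2 * h a - (\<Sum>i<length (\<sigma> a). (d a i)\<^sup>2 * h (\<sigma> a ! i)) / 2"
    and v_nonneg: "0 \<le> v"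
begin

definition F :: "real \<Rightarrow> ('a \<Rightarrow> real) \<Rightarrow> nat \<Rightarrow> complex" where
  "F s w N = (\<Sum>n<N. cis (s * T n) * of_real (w (u !! n)))"

lemma norm_F_le:
  assumes "\<And>a. \<bar>w a\<bar> \<le> c"
  shows "cmod (F s w N) \<le> c * real N"
proof -
  have "cmod (F s w N) \<le> (\<Sum>n<N. cmod (cis (s * T n) * of_real (w (u !! n))))"
    unfolding F_def by (rule norm_sum)
  also have "\<dots> \<le> (\<Sum>n<N. c)"
    by (intro sum_mono) (simp add: norm_mult assms)
  finally show ?thesis by (simp add: mult.commute)
qed

lemma F_linear:
  "F s (\<lambda>a. x * w a + y * w' a) N = of_real x * F s w N + of_real y * F s w' N"
  by (simp add: F_def sum.distrib sum_distrib_left algebra_simps)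

text \<open>
  Split the range of summation into blocks \<open>\<sigma> (u !! j)\<close>. The full blocks below \<open>N\<close> are those with
  \<open>j < parent N\<close>, and each contributes the perturbed transfer operator of \<open>w\<close> at the letter \<open>u !! j\<close>, which
  the hypothesis compares with \<open>\<beta> * w'\<close>. The last block is incomplete and has bounded length.
\<close>

lemma F_desubstitute:
  assumes w': "\<And>a. cmod ((\<Sum>i<length (\<sigma> a). cis (s * (m + d a i)) * of_real (w (\<sigma> a ! i)))
      - \<beta> * of_real (w' a)) \<le> \<epsilon>"
    and c: "\<And>a. \<bar>w a\<bar> \<le> c"
  shows "cmod (F s w N - \<beta> * F s w' (parent N)) \<le> real max_len * c + \<epsilon> * real (parent N)"
proof -
  define p where "p = parent N"
  obtain i where i: "i < length (\<sigma> (u !! p))" "N = image_len p + i"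
    using obtain_parent[of N] unfolding p_def by blast
  let ?B = "\<lambda>a. (\<Sum>i<length (\<sigma> a). cis (s * (m + d a i)) * of_real (w (\<sigma> a ! i))) :: complex"
  have "cis (s * T (image_len j + i)) = cis (s * T j) * cis (s * (m + d (u !! j) i))"
    if "i < length (\<sigma> (u !! j))" for i j
    by (simp add: step[OF that] cis_mult distrib_left add.assoc)
  then have "F s w (image_len p) = (\<Sum>j<p. cis (s * T j) * ?B (u !! j))"
    unfolding F_def sum_image_len sum_distrib_left
    by (intro sum.cong refl) (simp add: snth_image_len mult.assoc)
  then have "F s w N - \<beta> * F s w' p
      = (\<Sum>j<p. cis (s * T j) * (?B (u !! j) - \<beta> * of_real (w' (u !! j))))
        + (\<Sum>i<i. cis (s * T (image_len p + i)) * of_real (w (u !! (image_len p + i))))"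
    unfolding i(2) F_def sum_lessThan_add
    by (simp add: right_diff_distrib sum_subtractf sum_distrib_left mult_ac)
  also have "cmod \<dots> \<le> real p * \<epsilon> + real i * c"
  proof (rule norm_triangle_le, rule add_mono)
    show "cmod (\<Sum>j<p. cis (s * T j) * (?B (u !! j) - \<beta> * of_real (w' (u !! j)))) \<le> real p * \<epsilon>"
      by (rule order_trans[OF sum_norm_le[where g = "\<lambda>_. \<epsilon>"]]) (use w' in \<open>simp_all add: norm_mult\<close>)
    show "cmod (\<Sum>i<i. cis (s * T (image_len p + i)) * of_real (w (u !! (image_len p + i)))) \<le> real i * c"
      by (rule order_trans[OF sum_norm_le[where g = "\<lambda>_. c"]]) (use c in \<open>simp_all add: norm_mult\<close>)
  qed
  also have "real i * c \<le> real max_len * c"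
  proof (rule mult_right_mono)
    show "real i \<le> real max_len" using i(1) length_le_max_len[of "u !! p"] by simp
    show "0 \<le> c" using c[of undefined] abs_ge_zero order_trans by blast
  qed
  finally show ?thesis by (simp add: p_def mult.commute add.commute)
qed

text \<open>
  In the \<open>j\<close>-th step the range has length \<open>O(N / \<rho>^j)\<close> and the factor \<open>\<beta>^j\<close> is at most \<open>\<rho>^j\<close>, so the
  eigenvector error \<open>\<epsilon>\<close> costs \<open>O(\<epsilon> * N)\<close> per step, while the incomplete blocks add up to a
  geometric series.
\<close>

lemma F_iterate:
  assumes \<beta>: "cmod \<beta> \<le> \<rho>"
    and w: "\<And>a. cmod ((\<Sum>i<length (\<sigma> a). cis (s * (m + d a i)) * of_real (w (\<sigma> a ! i)))
      - \<beta> * of_real (w a)) \<le> \<epsilon>"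
    and c: "\<And>a. \<bar>w a\<bar> \<le> c"
    and C: "\<And>j N. real ((parent ^^ j) N) \<le> C * real N / \<rho> ^ j"
  shows "cmod (F s w N - \<beta> ^ j * F s w ((parent ^^ j) N))
    \<le> real max_len * c * \<rho> ^ j / (\<rho> - 1) + real j * \<epsilon> * C * real N"
proof (induction j)
  case 0
  have "0 \<le> c" using c[of undefined] abs_ge_zero order_trans by blast
  then show ?case using rho_gt_1 by simp
next
  case (Suc j)
  have "0 \<le> \<epsilon>" using w[of undefined] norm_ge_zero order_trans by blast
  let ?P = "(parent ^^ j) N"
  let ?R = "F s w ?P - \<beta> * F s w (parent ?P)"
  have "cmod (\<beta> ^ j * ?R) \<le> \<rho> ^ j * (real max_len * c + \<epsilon> * real (parent ?P))"
    unfolding norm_mult norm_power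
    using F_desubstitute[OF w c] \<beta> rho_pos by (intro mult_mono power_mono) auto
  also have "\<dots> = real max_len * c * \<rho> ^ j + \<epsilon> * (\<rho> ^ j * real (parent ?P))"
    by (simp add: algebra_simps)
  also have "\<rho> ^ j * real (parent ?P) \<le> \<rho> ^ j * (C * real N / \<rho> ^ j)"
    using C[of j N] parent_le[of ?P] rho_pos by (intro mult_left_mono) auto
  also have "\<dots> = C * real N" using rho_pos by simp
  finally have R: "cmod (\<beta> ^ j * ?R) \<le> real max_len * c * \<rho> ^ j + \<epsilon> * (C * real N)"
    using \<open>0 \<le> \<epsilon>\<close> by (simp add: mult_left_mono)
  have eq: "F s w N - \<beta> ^ Suc j * F s w ((parent ^^ Suc j) N) = (F s w N - \<beta> ^ j * F s w ?P) + \<beta> ^ j * ?R"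
    by (simp add: algebra_simps)
  have "cmod (F s w N - \<beta> ^ Suc j * F s w ((parent ^^ Suc j) N))
      \<le> (real max_len * c * \<rho> ^ j / (\<rho> - 1) + real j * \<epsilon> * C * real N)
        + (real max_len * c * \<rho> ^ j + \<epsilon> * (C * real N))"
    unfolding eq by (rule norm_triangle_mono[OF Suc.IH R])
  also have "\<dots> = real max_len * c * \<rho> ^ Suc j / (\<rho> - 1) + real (Suc j) * \<epsilon> * C * real N"
    using rho_gt_1 by (simp add: field_simps)
  finally show ?case .
qed

text \<open>
  The Gaussian factor is written as an exponential, rather than as \<open>1 - v s\<^sup>2 / 2\<close>, so that its powers
  are explicit and \<open>cmod (beta s) \<le> \<rho>\<close> for all \<open>s\<close>.
\<close>

definition beta :: "real \<Rightarrow> complex" where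
  "beta s = of_real (\<rho> * exp (- (v * s\<^sup>2 / 2))) * cis (s * m)"

definition corrected_h :: "real \<Rightarrow> 'a \<Rightarrow> real" where
  "corrected_h s a = h a - s\<^sup>2 * k a"

lemma norm_beta_le: "cmod (beta s) \<le> \<rho>"
  using rho_pos v_nonneg by (simp add: beta_def norm_mult)

text \<open>
  Expand \<open>cis (s * d a i)\<close> to second order. The terms of order one cancel by \<open>mean_zero\<close>, those
  of order two by the equation for \<open>k\<close>. What is left are the remainders \<open>R\<close>, \<open>Q\<close>, \<open>z\<close> of the expansions
  of \<open>cis\<close> and \<open>exp\<close>, all of order at least three.
\<close>

lemma approximate_eigenvector:
  obtains E where "0 \<le> E" "\<And>s a. \<bar>s\<bar> \<le> 1 \<Longrightarrow>
    cmod ((\<Sum>i<length (\<sigma> a). cis (s * (m + d a i)) * of_real (corrected_h s (\<sigma> a ! i)))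
      - beta s * of_real (corrected_h s a)) \<le> E * \<bar>s\<bar> ^ 3"
proof -
  define Ea where "Ea a = (\<Sum>i<length (\<sigma> a). \<bar>d a i\<bar> ^ 3 * h (\<sigma> a ! i))
    + (\<Sum>i<length (\<sigma> a). \<bar>d a i\<bar> * \<bar>k (\<sigma> a ! i)\<bar>) + \<rho> * v\<^sup>2 * h a + \<rho> * v * \<bar>k a\<bar>" for a
  have Ea_nonneg: "0 \<le> Ea a" for a
    unfolding Ea_def using rho_pos v_nonneg h_pos
    by (intro add_nonneg_nonneg sum_nonneg mult_nonneg_nonneg) (auto simp: less_imp_le)
  have bound: "cmod ((\<Sum>i<length (\<sigma> a). cis (s * (m + d a i)) * of_real (corrected_h s (\<sigma> a ! i)))
      - beta s * of_real (corrected_h s a)) \<le> Ea a * \<bar>s\<bar> ^ 3" if s: "\<bar>s\<bar> \<le> 1" for s a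
  proof -
    let ?I = "{..<length (\<sigma> a)}"
    define V where "V = (\<Sum>i\<in>?I. (d a i)\<^sup>2 * h (\<sigma> a ! i))"
    define R where "R i = cis (s * d a i) - (1 + \<i> * of_real (s * d a i) - of_real ((s * d a i)\<^sup>2) / 2)" for i
    define Q where "Q i = cis (s * d a i) - 1" for i
    define y where "y = v * s\<^sup>2 / 2"
    define z where "z = exp (- y) - (1 - y)"
    have y: "0 \<le> y" using v_nonneg by (simp add: y_def)
    have s3: "s ^ 4 \<le> \<bar>s\<bar> ^ 3"
      using power_decreasing[of 3 4 "\<bar>s\<bar>"] s by simp
    have cube: "s\<^sup>2 * \<bar>s\<bar> = \<bar>s\<bar> ^ 3"
      by (simp add: power3_eq_cube power2_eq_square flip: abs_mult)
    have "(\<Sum>i\<in>?I. cis (s * d a i) * of_real (corrected_h s (\<sigma> a ! i)))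
      = (\<Sum>i\<in>?I. of_real (h (\<sigma> a ! i)) + \<i> * of_real s * of_real (d a i * h (\<sigma> a ! i))
          - of_real (s\<^sup>2) / 2 * of_real ((d a i)\<^sup>2 * h (\<sigma> a ! i))
          + R i * of_real (h (\<sigma> a ! i))
          - of_real (s\<^sup>2) * of_real (k (\<sigma> a ! i)) - of_real (s\<^sup>2) * (Q i * of_real (k (\<sigma> a ! i))))"
      by (intro sum.cong refl) (simp add: R_def Q_def corrected_h_def field_simps power_mult_distrib)
    also have "\<dots> = of_real (app h a) + \<i> * of_real s * of_real (\<Sum>i\<in>?I. d a i * h (\<sigma> a ! i))
          - of_real (s\<^sup>2) / 2 * of_real V + (\<Sum>i\<in>?I. R i * of_real (h (\<sigma> a ! i)))
          - of_real (s\<^sup>2) * of_real (app k a) - of_real (s\<^sup>2) * (\<Sum>i\<in>?I. Q i * of_real (k (\<sigma> a ! i)))"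
      by (simp only: sum.distrib sum_subtractf sum_distrib_left[symmetric] of_real_sum[symmetric]
          app_eq_nth V_def)
    also have "app k a = \<rho> * k a + \<rho> * v / 2 * h a - V / 2"
      using variance[of a] by (simp add: V_def)
    finally have lhs: "(\<Sum>i\<in>?I. cis (s * d a i) * of_real (corrected_h s (\<sigma> a ! i)))
      = of_real (\<rho> * h a - s\<^sup>2 * (\<rho> * k a + \<rho> * v / 2 * h a))
        + ((\<Sum>i\<in>?I. R i * of_real (h (\<sigma> a ! i))) - of_real (s\<^sup>2) * (\<Sum>i\<in>?I. Q i * of_real (k (\<sigma> a ! i))))"
      by (simp add: mean_zero app_h algebra_simps)
    have rhs: "\<rho> * exp (- y) * corrected_h s a
      = \<rho> * h a - s\<^sup>2 * (\<rho> * k a + \<rho> * v / 2 * h a)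
        + (\<rho> * z * h a - \<rho> * s\<^sup>2 * (exp (- y) - 1) * k a)"
      by (simp add: corrected_h_def z_def y_def algebra_simps)
    have "(\<Sum>i\<in>?I. cis (s * (m + d a i)) * of_real (corrected_h s (\<sigma> a ! i))) - beta s * of_real (corrected_h s a)
      = cis (s * m) * ((\<Sum>i\<in>?I. cis (s * d a i) * of_real (corrected_h s (\<sigma> a ! i))) - of_real (\<rho> * exp (- y) * corrected_h s a))"
      by (simp add: beta_def y_def right_diff_distrib sum_distrib_left cis_mult[symmetric] distrib_left mult_ac)
    also have "cmod \<dots> = cmod ((\<Sum>i\<in>?I. R i * of_real (h (\<sigma> a ! i)))
        - of_real (s\<^sup>2) * (\<Sum>i\<in>?I. Q i * of_real (k (\<sigma> a ! i)))
        - of_real (\<rho> * z * h a) + of_real (\<rho> * s\<^sup>2 * (exp (- y) - 1) * k a))"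
      unfolding lhs rhs norm_mult by (simp add: algebra_simps)
    also have "\<dots> \<le> cmod (\<Sum>i\<in>?I. R i * of_real (h (\<sigma> a ! i)))
        + cmod (of_real (s\<^sup>2) * (\<Sum>i\<in>?I. Q i * of_real (k (\<sigma> a ! i))))
        + cmod (of_real (\<rho> * z * h a)) + cmod (of_real (\<rho> * s\<^sup>2 * (exp (- y) - 1) * k a))"
      by (intro norm_triangle_mono order_trans[OF norm_triangle_ineq4] add_mono order_refl)
    also have "\<dots> \<le> (\<Sum>i\<in>?I. \<bar>d a i\<bar> ^ 3 * h (\<sigma> a ! i)) * \<bar>s\<bar> ^ 3
        + (\<Sum>i\<in>?I. \<bar>d a i\<bar> * \<bar>k (\<sigma> a ! i)\<bar>) * \<bar>s\<bar> ^ 3 + \<rho> * v\<^sup>2 * h a * \<bar>s\<bar> ^ 3 + \<rho> * v * \<bar>k a\<bar> * \<bar>s\<bar> ^ 3"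
    proof (intro add_mono)
      have "cmod (\<Sum>i\<in>?I. R i * of_real (h (\<sigma> a ! i))) \<le> (\<Sum>i\<in>?I. \<bar>s * d a i\<bar> ^ 3 * h (\<sigma> a ! i))"
      proof (rule sum_norm_le)
        fix i
        have "cmod (R i) \<le> \<bar>s * d a i\<bar> ^ 3"
          using cis_approx3[of "s * d a i"] by (simp add: R_def)
        then show "cmod (R i * of_real (h (\<sigma> a ! i))) \<le> \<bar>s * d a i\<bar> ^ 3 * h (\<sigma> a ! i)"
          using h_pos[of "\<sigma> a ! i"] by (simp add: norm_mult mult_right_mono)
      qed
      then show "cmod (\<Sum>i\<in>?I. R i * of_real (h (\<sigma> a ! i)))
          \<le> (\<Sum>i\<in>?I. \<bar>d a i\<bar> ^ 3 * h (\<sigma> a ! i)) * \<bar>s\<bar> ^ 3"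
        by (simp add: abs_mult power_mult_distrib sum_distrib_left sum_distrib_right mult_ac)
      have "cmod (\<Sum>i\<in>?I. Q i * of_real (k (\<sigma> a ! i))) \<le> (\<Sum>i\<in>?I. \<bar>s * d a i\<bar> * \<bar>k (\<sigma> a ! i)\<bar>)"
        using cis_approx1 unfolding Q_def
        by (intro sum_norm_le) (simp add: norm_mult mult_right_mono)
      then have "s\<^sup>2 * cmod (\<Sum>i\<in>?I. Q i * of_real (k (\<sigma> a ! i))) \<le> s\<^sup>2 * (\<Sum>i\<in>?I. \<bar>s * d a i\<bar> * \<bar>k (\<sigma> a ! i)\<bar>)"
        by (rule mult_left_mono) simp
      also have "\<dots> = (\<Sum>i\<in>?I. \<bar>d a i\<bar> * \<bar>k (\<sigma> a ! i)\<bar>) * \<bar>s\<bar> ^ 3"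
        unfolding cube[symmetric] by (simp add: abs_mult sum_distrib_left sum_distrib_right mult_ac)
      finally show "cmod (of_real (s\<^sup>2) * (\<Sum>i\<in>?I. Q i * of_real (k (\<sigma> a ! i))))
          \<le> (\<Sum>i\<in>?I. \<bar>d a i\<bar> * \<bar>k (\<sigma> a ! i)\<bar>) * \<bar>s\<bar> ^ 3"
        by (simp add: norm_mult norm_power)
      have "\<bar>z\<bar> \<le> y\<^sup>2" unfolding z_def by (rule exp_minus_approx[OF y])
      also have "y\<^sup>2 = v\<^sup>2 / 4 * s ^ 4"
        by (simp add: y_def power2_eq_square power4_eq_xxxx)
      also have "\<dots> \<le> v\<^sup>2 * \<bar>s\<bar> ^ 3"
        using s3 by (intro mult_mono) auto
      finally have "\<rho> * \<bar>z\<bar> * h a \<le> \<rho> * (v\<^sup>2 * \<bar>s\<bar> ^ 3) * h a"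
        using rho_pos h_pos by (intro mult_left_mono mult_right_mono) (auto simp: less_imp_le)
      then show "cmod (of_real (\<rho> * z * h a)) \<le> \<rho> * v\<^sup>2 * h a * \<bar>s\<bar> ^ 3"
        unfolding norm_of_real using rho_pos h_pos[of a] by (simp add: abs_mult mult_ac)
      have "s\<^sup>2 * \<bar>exp (- y) - 1\<bar> \<le> s\<^sup>2 * y"
        using exp_minus_approx(1)[OF y] by (rule mult_left_mono) simp
      also have "\<dots> = v / 2 * s ^ 4" by (simp add: y_def power2_eq_square power4_eq_xxxx)
      also have "\<dots> \<le> v * \<bar>s\<bar> ^ 3" using s3 v_nonneg by (intro mult_mono) auto
      finally have "\<rho> * (s\<^sup>2 * \<bar>exp (- y) - 1\<bar>) * \<bar>k a\<bar> \<le> \<rho> * (v * \<bar>s\<bar> ^ 3) * \<bar>k a\<bar>"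
        using rho_pos by (intro mult_left_mono mult_right_mono) auto
      then show "cmod (of_real (\<rho> * s\<^sup>2 * (exp (- y) - 1) * k a)) \<le> \<rho> * v * \<bar>k a\<bar> * \<bar>s\<bar> ^ 3"
        unfolding norm_of_real using rho_pos by (simp add: abs_mult mult_ac)
    qed
    finally show ?thesis by (simp add: Ea_def distrib_right)
  qed
  show ?thesis
  proof (rule that[of "\<Sum>a\<in>UNIV. Ea a"])
    show "0 \<le> (\<Sum>a\<in>UNIV. Ea a)" by (intro sum_nonneg Ea_nonneg)
    fix s a assume "\<bar>s\<bar> \<le> (1::real)"
    have "Ea a \<le> (\<Sum>a\<in>UNIV. Ea a)" by (rule member_le_sum) (auto simp: Ea_nonneg)
    with bound[OF \<open>\<bar>s\<bar> \<le> 1\<close>, of a]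
    show "cmod ((\<Sum>i<length (\<sigma> a). cis (s * (m + d a i)) * of_real (corrected_h s (\<sigma> a ! i)))
      - beta s * of_real (corrected_h s a)) \<le> (\<Sum>a\<in>UNIV. Ea a) * \<bar>s\<bar> ^ 3"
      by (meson mult_right_mono order_trans zero_le_power abs_ge_zero)
  qed
qed

end

section \<open>Asymptotics of the twisted sums\<close>

text \<open>
  The form in which error bounds arise below: the number \<open>J\<close> of desubstitution steps that are left out
  (or, for \<open>F_annihilated\<close>, carried out) is fixed first, and only then \<open>N\<close> tends to infinity.
\<close>

lemma tendsto_zero_approximate_bounds:
  fixes z :: "nat \<Rightarrow> 'b::real_normed_vector"
  assumes c: "c \<longlonglongrightarrow> (0::real)"
    and y: "\<And>J. y J \<longlonglongrightarrow> (0::real)"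
    and le: "\<And>J::nat. \<forall>\<^sub>F N in sequentially. norm (z N) \<le> c J + y J N"
  shows "z \<longlonglongrightarrow> 0"
proof (rule tendstoI)
  fix e :: real assume "0 < e"
  then have "\<forall>\<^sub>F J in sequentially. c J < e / 2"
    using order_tendstoD(2)[OF c, of "e / 2"] by simp
  then obtain J where J: "c J < e / 2" by (meson eventually_False_sequentially eventually_mono)
  have "\<forall>\<^sub>F N in sequentially. y J N < e / 2"
    using order_tendstoD(2)[OF y, of "e / 2" J] \<open>0 < e\<close> by simp
  with le[of J] show "\<forall>\<^sub>F N in sequentially. dist (z N) 0 < e"
    by eventually_elim (use J in auto)
qed

context martingale_cocycle
begin

lemma F_zero_h: "F 0 h n = of_real (perron_len n)"
  by (simp add: F_def perron_len_def)

text \<open>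
  Desubstitute \<open>j = \<lfloor>log N\<rfloor> - J\<close> times. The range of summation that remains is bounded in terms of \<open>J\<close>,
  and on a bounded range \<open>F s (corrected_h s)\<close> tends to the weighted length as \<open>s\<close> tends to 0. The
  phases \<open>cis (s m)\<close> of the eigenvalues cancel the centring except for \<open>J + O(1)\<close> of them, which
  tend to 1, and \<open>j s\<^sup>2\<close> tends to \<open>t\<^sup>2\<close>. The incomplete blocks cost \<open>O(\<rho>^j)\<close>, a proportion
  \<open>O(\<rho>^(-J))\<close> of \<open>N\<close>, both in the twisted sum and in the weighted length \<open>F 0 h\<close>.
\<close>

theorem F_h_asymptotics:
  fixes t :: real
  defines "s \<equiv> \<lambda>N. t / sqrt (log \<rho> (real N))"
  shows "(\<lambda>N. (cis (- (m * (s N * log \<rho> (real N)))) * F (s N) h N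
           - of_real (exp (- (v * t\<^sup>2 / 2)) * perron_len N)) / of_nat N) \<longlonglongrightarrow> 0"
proof -
  define lg where "lg N = log \<rho> (real N)" for N
  obtain E where E: "0 \<le> E" "\<And>s a. \<bar>s\<bar> \<le> 1 \<Longrightarrow>
    cmod ((\<Sum>i<length (\<sigma> a). cis (s * (m + d a i)) * of_real (corrected_h s (\<sigma> a ! i)))
      - beta s * of_real (corrected_h s a)) \<le> E * \<bar>s\<bar> ^ 3"
    using approximate_eigenvector by blast
  obtain C where C: "0 < C" "\<And>j N. real ((parent ^^ j) N) \<le> C * real N / \<rho> ^ j"
    using parent_funpow_le by blast
  define kk where "kk = (\<Sum>a\<in>UNIV. \<bar>k a\<bar>)"
  define c where "c = (\<Sum>a\<in>UNIV. h a) + kk"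
  define C3 where "C3 = real max_len * c / (\<rho> - 1)"
  have kk: "\<bar>k a\<bar> \<le> kk" for a
    unfolding kk_def by (rule member_le_sum) auto
  have kk0: "0 \<le> kk" unfolding kk_def by (intro sum_nonneg) auto
  have hc: "\<bar>h a\<bar> \<le> c" for a
    using member_le_sum[of a UNIV h] h_pos kk0 by (simp add: c_def less_imp_le)
  have hsc: "\<bar>corrected_h s a\<bar> \<le> c" if "\<bar>s\<bar> \<le> 1" for s a
  proof -
    have "s\<^sup>2 * \<bar>k a\<bar> \<le> 1 * kk"
      using that kk by (intro mult_mono) (auto simp: abs_square_le_1)
    moreover have "h a \<le> (\<Sum>a\<in>UNIV. h a)"
      by (rule member_le_sum) (auto simp: h_pos less_imp_le)
    moreover have "\<bar>corrected_h s a\<bar> \<le> h a + s\<^sup>2 * \<bar>k a\<bar>"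
      using abs_triangle_ineq4[of "h a" "s\<^sup>2 * k a"] h_pos[of a] by (simp add: corrected_h_def abs_mult)
    ultimately show ?thesis by (simp add: c_def)
  qed
  have lg_top: "filterlim lg at_top sequentially"
    unfolding lg_def using rho_gt_1 by real_asymp
  have s_0: "s \<longlonglongrightarrow> 0"
    unfolding s_def lg_def[symmetric]
    by (intro tendsto_divide_0[OF tendsto_const] filterlim_at_top_imp_at_infinity
          filterlim_compose[OF sqrt_at_top lg_top])
  have s_lg: "\<forall>\<^sub>F N in sequentially. (s N)\<^sup>2 * lg N = t\<^sup>2"
    using filterlim_at_top_dense[THEN iffD1, OF lg_top, rule_format, of 0]
    by eventually_elim (simp add: s_def lg_def[symmetric] power_divide)
  define j where "j J N = nat \<lfloor>lg N\<rfloor> - J" for J N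
  have j_le: "\<forall>\<^sub>F N in sequentially. lg N - J - 1 \<le> real (j J N) \<and> real (j J N) \<le> lg N - J" for J
    using filterlim_at_top_dense[THEN iffD1, OF lg_top, rule_format, of "real J + 1"]
  proof eventually_elim
    case (elim N)
    then have "int J \<le> \<lfloor>lg N\<rfloor>" by (simp add: le_floor_iff)
    then have "real (j J N) = of_int \<lfloor>lg N\<rfloor> - real J"
      by (simp add: j_def of_nat_diff nat_le_iff le_nat_iff)
    then show ?case by linarith
  qed
  have s_j: "(\<lambda>N. s N * (lg N - real (j J N))) \<longlonglongrightarrow> 0" for J
  proof (rule Lim_null_comparison)
    show "\<forall>\<^sub>F N in sequentially. norm (s N * (lg N - real (j J N))) \<le> \<bar>s N\<bar> * (real J + 1)"
      using j_le[of J] by eventually_elim (auto simp: abs_mult intro!: mult_left_mono)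
    show "(\<lambda>N. \<bar>s N\<bar> * (real J + 1)) \<longlonglongrightarrow> 0"
      using tendsto_mult_left_zero[OF tendsto_rabs_zero[OF s_0]] .
  qed
  have s2_j: "(\<lambda>N. (s N)\<^sup>2 * real (j J N)) \<longlonglongrightarrow> t\<^sup>2" for J
  proof -
    have "(\<lambda>N. (s N)\<^sup>2 * lg N - s N * (s N * (lg N - real (j J N)))) \<longlonglongrightarrow> t\<^sup>2 - 0 * 0"
      by (intro tendsto_diff tendsto_mult s_0 s_j tendsto_eventually[OF s_lg])
    then show ?thesis by (simp add: algebra_simps power2_eq_square)
  qed
  \<comment> \<open>What remains of the error after \<open>j J N\<close> steps, divided by \<open>\<rho> ^ j J N\<close>, if the range of
    summation has shrunk to \<open>n\<close>. The value of \<open>n\<close> depends on \<open>N\<close> but stays below a bound \<open>Q J\<close>, so the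
    pointwise limit is uniform.\<close>
  define D where "D J N n = cis (- (m * (s N * (lg N - real (j J N)))))
      * of_real (exp (- (v * ((s N)\<^sup>2 * real (j J N)) / 2))) * F (s N) (corrected_h (s N)) n
      - of_real (exp (- (v * t\<^sup>2 / 2)) * perron_len n)" for J N n
  have D: "(\<lambda>N. D J N n) \<longlonglongrightarrow> 0" for J n
  proof -
    have cis_lim: "((\<lambda>N. cis (x N)) \<longlongrightarrow> cis l) sequentially" if "x \<longlonglongrightarrow> l" for x l
      unfolding cis_conv_exp by (intro tendsto_intros that)
    have "(\<lambda>N. F (s N) (corrected_h (s N)) n) \<longlonglongrightarrow> (\<Sum>n<n. cis (0 * T n) * of_real (h (u !! n) - 0\<^sup>2 * k (u !! n)))"
      unfolding F_def corrected_h_def by (intro tendsto_intros cis_lim s_0)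
    then have "(\<lambda>N. F (s N) (corrected_h (s N)) n) \<longlonglongrightarrow> of_real (perron_len n)"
      by (simp add: perron_len_def)
    then have "(\<lambda>N. D J N n) \<longlonglongrightarrow> cis (- (m * 0)) * of_real (exp (- (v * t\<^sup>2 / 2))) * of_real (perron_len n)
      - of_real (exp (- (v * t\<^sup>2 / 2)) * perron_len n)"
      unfolding D_def by (intro tendsto_intros cis_lim s_j s2_j) auto
    then show ?thesis by simp
  qed
  define Q where "Q J = nat \<lceil>C * \<rho> ^ Suc J\<rceil>" for J
  define Y where "Y J N = (s N)\<^sup>2 * kk + (s N)\<^sup>2 * real (j J N) * \<bar>s N\<bar> * (E * C) + (\<Sum>n\<le>Q J. cmod (D J N n))" for J N
  have Y: "Y J \<longlonglongrightarrow> 0" for J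
  proof -
    have "Y J \<longlonglongrightarrow> 0\<^sup>2 * kk + t\<^sup>2 * \<bar>0\<bar> * (E * C) + (\<Sum>n\<le>Q J. 0)"
      unfolding Y_def by (intro tendsto_intros s_0 s2_j tendsto_norm_zero D)
    then show ?thesis by simp
  qed
  have bound: "\<forall>\<^sub>F N in sequentially. cmod ((cis (- (m * (s N * lg N))) * F (s N) h N
           - of_real (exp (- (v * t\<^sup>2 / 2)) * perron_len N)) / of_nat N) \<le> 2 * C3 / \<rho> ^ J + Y J N" for J
  proof -
    have s_le: "\<forall>\<^sub>F N in sequentially. \<bar>s N\<bar> < 1"
      using order_tendstoD(2)[OF tendsto_rabs_zero[OF s_0], of 1] by simp
    show ?thesis
      using s_le j_le[of J] eventually_gt_at_top[of 0]
    proof eventually_elim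
      case (elim N)
      let ?s = "s N" and ?j = "j J N"
      let ?P = "(parent ^^ ?j) N"
      let ?x = "exp (- (v * t\<^sup>2 / 2))"
      let ?c = "cis (- (m * (?s * lg N)))"
      have N: "0 < real N" using elim by simp
      have C3: "0 \<le> C3" using rho_gt_1 hc[of undefined] unfolding C3_def
        by (intro divide_nonneg_nonneg mult_nonneg_nonneg) auto
      have N_powr: "real N = \<rho> powr lg N"
        using N rho_gt_1 by (simp add: lg_def)
      have pow: "\<rho> ^ ?j = \<rho> powr real ?j" "\<rho> ^ J = \<rho> powr real J" "\<rho> ^ Suc J = \<rho> powr (real J + 1)"
        using rho_pos by (simp_all add: powr_realpow[symmetric] powr_add)
      have up: "\<rho> ^ ?j \<le> real N / \<rho> ^ J"
        unfolding pow N_powr powr_diff[symmetric] using elim rho_gt_1 by (intro powr_mono) auto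
      have "real N / \<rho> ^ ?j \<le> \<rho> ^ Suc J"
        unfolding pow N_powr powr_diff[symmetric] using elim rho_gt_1 by (intro powr_mono) auto
      then have "C * (real N / \<rho> ^ ?j) \<le> C * \<rho> ^ Suc J"
        using C(1) by (intro mult_left_mono) auto
      then have "real ?P \<le> C * \<rho> ^ Suc J"
        using C(2)[of ?j N] by simp
      then have P: "?P \<le> Q J" unfolding Q_def by linarith
      have "\<rho> ^ ?j \<le> real N"
        using up N rho_gt_1 by (auto intro!: order_trans[OF up] simp: divide_le_eq mult_le_cancel_left1)
      \<comment> \<open>The four differences are the replacement of \<open>h\<close> by the approximate eigenvector, the
        desubstitution of the twisted sum, the limit on the bounded range, and the desubstitution of
        the weighted length.\<close>
      have A1: "cmod (?c * (F ?s h N - F ?s (corrected_h ?s) N)) \<le> ?s\<^sup>2 * kk * real N"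
      proof -
        have "F ?s h N - F ?s (corrected_h ?s) N = F ?s (\<lambda>a. ?s\<^sup>2 * k a) N"
          by (simp add: F_def corrected_h_def sum_subtractf[symmetric] algebra_simps)
        also have "cmod \<dots> \<le> ?s\<^sup>2 * kk * real N"
          by (rule norm_F_le) (simp add: abs_mult mult_left_mono kk)
        finally show ?thesis by (simp add: norm_mult)
      qed
      have A2: "cmod (?c * (F ?s (corrected_h ?s) N - beta ?s ^ ?j * F ?s (corrected_h ?s) ?P))
          \<le> C3 * \<rho> ^ ?j + ?s\<^sup>2 * real ?j * \<bar>?s\<bar> * (E * C) * real N"
      proof -
        have "cmod (F ?s (corrected_h ?s) N - beta ?s ^ ?j * F ?s (corrected_h ?s) ?P)
          \<le> real max_len * c * \<rho> ^ ?j / (\<rho> - 1) + real ?j * (E * \<bar>?s\<bar> ^ 3) * C * real N"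
          using elim by (intro F_iterate norm_beta_le E(2) hsc C(2)) auto
        moreover have "\<bar>?s\<bar> ^ 3 = ?s\<^sup>2 * \<bar>?s\<bar>"
          by (simp add: power3_eq_cube power2_eq_square flip: abs_mult)
        ultimately show ?thesis by (simp add: norm_mult C3_def mult_ac)
      qed
      have A3: "cmod (?c * (beta ?s ^ ?j * F ?s (corrected_h ?s) ?P) - \<rho> ^ ?j * of_real (?x * perron_len ?P))
          \<le> (\<Sum>n\<le>Q J. cmod (D J N n)) * real N"
      proof -
        have "?c * cis (?s * m) ^ ?j = cis (- (m * (?s * (lg N - real ?j))))"
          unfolding Complex.DeMoivre cis_mult by (simp add: algebra_simps)
        moreover have "exp (- (v * ?s\<^sup>2 / 2)) ^ ?j = exp (- (v * (?s\<^sup>2 * real ?j) / 2))"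
          by (simp add: exp_of_nat_mult[symmetric] mult_ac)
        ultimately have "?c * (beta ?s ^ ?j * F ?s (corrected_h ?s) ?P) - \<rho> ^ ?j * of_real (?x * perron_len ?P)
            = \<rho> ^ ?j * D J N ?P"
          unfolding beta_def D_def power_mult_distrib of_real_mult of_real_power[symmetric]
          by (simp add: right_diff_distrib mult_ac)
        also have "cmod \<dots> = \<rho> ^ ?j * cmod (D J N ?P)"
          using rho_pos by (simp add: norm_mult norm_power)
        also have "\<dots> \<le> real N * (\<Sum>n\<le>Q J. cmod (D J N n))"
          using P \<open>\<rho> ^ ?j \<le> real N\<close> by (intro mult_mono member_le_sum) auto
        finally show ?thesis by (simp add: mult.commute)
      qed
      have A4: "cmod (of_real ?x * (F 0 h N - \<rho> ^ ?j * F 0 h ?P)) \<le> C3 * \<rho> ^ ?j"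
      proof -
        have "cmod (F 0 h N - of_real \<rho> ^ ?j * F 0 h ?P)
          \<le> real max_len * c * \<rho> ^ ?j / (\<rho> - 1) + real ?j * 0 * C * real N"
        proof (rule F_iterate[OF _ _ hc C(2)])
          show "cmod ((\<Sum>i<length (\<sigma> a). cis (0 * (m + d a i)) * of_real (h (\<sigma> a ! i)))
            - of_real \<rho> * of_real (h a)) \<le> 0" for a
            using app_h[of a] by (simp add: app_eq_nth flip: of_real_sum of_real_mult)
        qed (use rho_pos in auto)
        then have *: "cmod (F 0 h N - \<rho> ^ ?j * F 0 h ?P) \<le> C3 * \<rho> ^ ?j"
          by (simp add: C3_def)
        have "?x \<le> 1" using v_nonneg by simp
        then have "?x * cmod (F 0 h N - \<rho> ^ ?j * F 0 h ?P) \<le> 1 * (C3 * \<rho> ^ ?j)"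
          using * by (intro mult_mono) auto
        then show ?thesis by (simp add: norm_mult)
      qed
      have eq: "?c * F ?s h N - of_real (?x * perron_len N)
          = ?c * (F ?s h N - F ?s (corrected_h ?s) N)
            + ?c * (F ?s (corrected_h ?s) N - beta ?s ^ ?j * F ?s (corrected_h ?s) ?P)
            + (?c * (beta ?s ^ ?j * F ?s (corrected_h ?s) ?P) - \<rho> ^ ?j * of_real (?x * perron_len ?P))
            - of_real ?x * (F 0 h N - \<rho> ^ ?j * F 0 h ?P)"
        by (simp add: F_zero_h algebra_simps)
      have "cmod (?c * F ?s h N - of_real (?x * perron_len N))
          \<le> ?s\<^sup>2 * kk * real N + (C3 * \<rho> ^ ?j + ?s\<^sup>2 * real ?j * \<bar>?s\<bar> * (E * C) * real N)
            + (\<Sum>n\<le>Q J. cmod (D J N n)) * real N + C3 * \<rho> ^ ?j"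
        unfolding eq
        by (rule order_trans[OF norm_triangle_ineq4], rule add_mono[OF _ A4], intro norm_triangle_mono A1 A2 A3)
      also have "\<dots> = 2 * C3 * \<rho> ^ ?j + Y J N * real N"
        by (simp add: Y_def algebra_simps)
      also have "\<dots> \<le> 2 * C3 * (real N / \<rho> ^ J) + Y J N * real N"
        using up C3 by (intro add_right_mono mult_left_mono) auto
      also have "\<dots> = (2 * C3 / \<rho> ^ J + Y J N) * real N"
        by (simp add: algebra_simps)
      finally show ?case
        using N by (simp add: norm_divide pos_divide_le_eq)
    qed
  qed
  have "(\<lambda>J. 2 * C3 / \<rho> ^ J) \<longlonglongrightarrow> 0"
    using rho_gt_1 by real_asymp
  from tendsto_zero_approximate_bounds[OF this Y bound] show ?thesis
    by (simp add: lg_def)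
qed

text \<open>
  For a fixed number of steps and small \<open>s\<close> the perturbation of the transfer operator itself can be
  neglected.
\<close>

lemma F_desubstitute_unperturbed:
  "\<exists>K\<ge>0. \<forall>s N. cmod (F s w N - F s ((app ^^ J) w) ((parent ^^ J) N)) \<le> K * (1 + \<bar>s\<bar> * real N)"
proof (induction J)
  case 0
  show ?case by (auto intro!: exI[of _ 0])
next
  case (Suc J)
  obtain K where K: "0 \<le> K"
    "\<And>s N. cmod (F s w N - F s ((app ^^ J) w) ((parent ^^ J) N)) \<le> K * (1 + \<bar>s\<bar> * real N)"
    using Suc.IH by blast
  define x where "x = (app ^^ J) w"
  define c where "c = (\<Sum>a\<in>UNIV. \<bar>x a\<bar>)"
  define Ka where "Ka a = (\<Sum>i<length (\<sigma> a). \<bar>m + d a i\<bar> * \<bar>x (\<sigma> a ! i)\<bar>)" for a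
  define K' where "K' = real max_len * c + (\<Sum>a\<in>UNIV. Ka a)"
  have Ka: "0 \<le> Ka a" for a unfolding Ka_def by (intro sum_nonneg) auto
  have c: "0 \<le> c" "\<bar>x a\<bar> \<le> c" for a
    unfolding c_def by (auto intro!: sum_nonneg member_le_sum)
  have K': "real max_len * c \<le> K'" "(\<Sum>a\<in>UNIV. Ka a) \<le> K'"
    using c Ka by (auto simp: K'_def sum_nonneg)
  have "0 \<le> K'" using K'(1) c(1) by (meson mult_nonneg_nonneg of_nat_0_le_iff order_trans)
  have one: "cmod (F s x N - F s (app x) (parent N)) \<le> K' * (1 + \<bar>s\<bar> * real N)" for s N
  proof -
    have "cmod (F s x N - 1 * F s (app x) (parent N))
        \<le> real max_len * c + (\<bar>s\<bar> * (\<Sum>a\<in>UNIV. Ka a)) * real (parent N)"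
    proof (rule F_desubstitute[OF _ c(2)])
      fix a
      have "(\<Sum>i<length (\<sigma> a). cis (s * (m + d a i)) * of_real (x (\<sigma> a ! i))) - 1 * of_real (app x a)
          = (\<Sum>i<length (\<sigma> a). (cis (s * (m + d a i)) - 1) * of_real (x (\<sigma> a ! i)))"
        by (simp add: app_eq_nth left_diff_distrib sum_subtractf)
      also have "cmod \<dots> \<le> (\<Sum>i<length (\<sigma> a). \<bar>s * (m + d a i)\<bar> * \<bar>x (\<sigma> a ! i)\<bar>)"
        using cis_approx1 by (intro sum_norm_le) (simp add: norm_mult mult_right_mono)
      also have "\<dots> = \<bar>s\<bar> * Ka a"
        by (simp add: Ka_def abs_mult sum_distrib_left mult.assoc)
      also have "\<dots> \<le> \<bar>s\<bar> * (\<Sum>a\<in>UNIV. Ka a)"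
        by (intro mult_left_mono member_le_sum) (auto simp: Ka)
      finally show "cmod ((\<Sum>i<length (\<sigma> a). cis (s * (m + d a i)) * of_real (x (\<sigma> a ! i)))
          - 1 * of_real (app x a)) \<le> \<bar>s\<bar> * (\<Sum>a\<in>UNIV. Ka a)" .
    qed
    also have "\<dots> \<le> K' + (\<bar>s\<bar> * K') * real N"
      using K' \<open>0 \<le> K'\<close> parent_le[of N] Ka by (intro add_mono mult_mono mult_nonneg_nonneg sum_nonneg) auto
    finally show ?thesis by (simp add: algebra_simps)
  qed
  have parent_funpow: "(parent ^^ J) N \<le> N" for N
    by (induction J) (auto intro: order_trans[OF parent_le])
  have "cmod (F s w N - F s (app x) (parent ((parent ^^ J) N))) \<le> (K + K') * (1 + \<bar>s\<bar> * real N)" for s N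
  proof -
    have "cmod (F s x ((parent ^^ J) N) - F s (app x) (parent ((parent ^^ J) N))) \<le> K' * (1 + \<bar>s\<bar> * real N)"
      using parent_funpow[of N] \<open>0 \<le> K'\<close>
      by (intro order_trans[OF one] mult_left_mono add_left_mono) auto
    from norm_triangle_mono[OF K(2)[of s N, folded x_def] this] show ?thesis
      by (simp add: distrib_right)
  qed
  then show ?case
    using K(1) \<open>0 \<le> K'\<close> by (intro exI[of _ "K + K'"]) (simp add: x_def)
qed

text \<open>
  After \<open>J\<close> steps the weight has size \<open>o(\<rho>^J)\<close> by the spectral gap, whereas the range of summation has
  length \<open>O(N / \<rho>^J)\<close>.
\<close>

lemma F_annihilated:
  assumes w: "pair w = 0" and s: "s \<longlonglongrightarrow> 0"
  shows "(\<lambda>N. F (s N) w N / of_nat N) \<longlonglongrightarrow> 0"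
proof -
  obtain C where C: "0 < C" "\<And>j N. real ((parent ^^ j) N) \<le> C * real N / \<rho> ^ j"
    using parent_funpow_le by blast
  obtain K where K: "\<And>J s N. cmod (F s w N - F s ((app ^^ J) w) ((parent ^^ J) N)) \<le> K J * (1 + \<bar>s\<bar> * real N)"
    using F_desubstitute_unperturbed[of w] by metis
  define R where "R = (\<Sum>a\<in>UNIV. 1 / r a)"
  define p where "p J = pair (\<lambda>a. \<bar>(app ^^ J) w a\<bar>)" for J
  have R: "\<bar>x a\<bar> \<le> R * pair (\<lambda>a. \<bar>x a\<bar>)" for x a
  proof -
    have "r a * \<bar>x a\<bar> \<le> pair (\<lambda>a. \<bar>x a\<bar>)"
      unfolding pair_def by (rule member_le_sum) (auto simp: r_pos less_imp_le)
    then have "\<bar>x a\<bar> \<le> 1 / r a * pair (\<lambda>a. \<bar>x a\<bar>)"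
      using r_pos[of a] by (simp add: field_simps)
    also have "\<dots> \<le> R * pair (\<lambda>a. \<bar>x a\<bar>)"
      unfolding R_def using pair_mono[of "\<lambda>_. 0" "\<lambda>a. \<bar>x a\<bar>"]
      by (intro mult_right_mono member_le_sum) (auto simp: r_pos less_imp_le pair_def)
    finally show ?thesis .
  qed
  have "(\<lambda>J. R * C * (p J / \<rho> ^ J)) \<longlonglongrightarrow> 0"
    unfolding p_def by (intro tendsto_mult_right_zero app_funpow_tendsto_zero w)
  moreover have "(\<lambda>N. K J * (1 / real N + \<bar>s N\<bar>)) \<longlonglongrightarrow> 0" for J
    using tendsto_add[OF lim_1_over_n tendsto_rabs_zero[OF s]]
    by (intro tendsto_mult_right_zero) simp
  moreover have "\<forall>\<^sub>F N in sequentially.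
      cmod (F (s N) w N / of_nat N) \<le> R * C * (p J / \<rho> ^ J) + K J * (1 / real N + \<bar>s N\<bar>)" for J
    using eventually_gt_at_top[of 0]
  proof eventually_elim
    case (elim N)
    let ?x = "(app ^^ J) w" and ?P = "(parent ^^ J) N"
    have p0: "0 \<le> R * p J"
      using R[of ?x undefined] unfolding p_def by linarith
    have "cmod (F (s N) ?x ?P) \<le> R * p J * real ?P"
      unfolding p_def by (intro norm_F_le R)
    also have "\<dots> \<le> R * p J * (C * real N / \<rho> ^ J)"
      using C(2) p0 by (intro mult_left_mono) auto
    finally have "cmod (F (s N) w N) \<le> R * p J * (C * real N / \<rho> ^ J) + K J * (1 + \<bar>s N\<bar> * real N)"
      using K[of "s N" N J] norm_triangle_sub[of "F (s N) w N" "F (s N) ?x ?P"] by linarith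
    also have "\<dots> = (R * C * (p J / \<rho> ^ J) + K J * (1 / real N + \<bar>s N\<bar>)) * real N"
      using elim rho_pos by (simp add: field_simps)
    finally show ?case using elim by (simp add: norm_divide pos_divide_le_eq)
  qed
  ultimately show ?thesis by (rule tendsto_zero_approximate_bounds)
qed

text \<open>
  The constant weight 1 is \<open>c * h\<close> plus a weight annihilated by \<open>r\<close>. The normalization comes from the
  same decomposition at \<open>s = 0\<close>, where the sum is \<open>N\<close>.
\<close>

theorem characteristic_function_limit:
  fixes t :: real
  defines "s \<equiv> \<lambda>N. t / sqrt (log \<rho> (real N))"
  shows "(\<lambda>N. (\<Sum>n<N. cis (s N * (T n - m * log \<rho> (real N)))) / of_nat N)
    \<longlonglongrightarrow> of_real (exp (- (v * t\<^sup>2 / 2)))"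
proof -
  define c where "c = pair (\<lambda>_. 1) / pair h"
  define w where "w a = 1 - c * h a" for a
  define e where "e N = cis (- (m * (s N * log \<rho> (real N))))" for N
  let ?x = "exp (- (v * t\<^sup>2 / 2))"
  have "pair w = 0"
    using pair_h_pos unfolding w_def pair_linear by (simp add: c_def)
  have F1: "F s (\<lambda>_. 1) N = of_real c * F s h N + F s w N" for s N
    using F_linear[of s c h 1 w N] by (simp add: w_def)
  have "filterlim (\<lambda>N. log \<rho> (real N)) at_top sequentially"
    using rho_gt_1 by real_asymp
  then have s_0: "s \<longlonglongrightarrow> 0"
    unfolding s_def
    by (intro tendsto_divide_0[OF tendsto_const] filterlim_at_top_imp_at_infinity
          filterlim_compose[OF sqrt_at_top])
  have cwlen: "(\<lambda>N. of_real c * of_real (perron_len N) / of_nat N) \<longlonglongrightarrow> (1::complex)"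
  proof -
    have "(\<lambda>N. 1 - F 0 w N / of_nat N) \<longlonglongrightarrow> 1 - 0"
      by (intro tendsto_diff tendsto_const F_annihilated \<open>pair w = 0\<close>)
    moreover have "\<forall>\<^sub>F N in sequentially. 1 - F 0 w N / of_nat N = of_real c * of_real (perron_len N) / of_nat N"
      using eventually_gt_at_top[of 0]
    proof eventually_elim
      case (elim N)
      have "of_nat N = of_real c * of_real (perron_len N) + F 0 w N"
        using F1[of 0 N] by (simp add: F_zero_h) (simp add: F_def)
      then have "of_real c * of_real (perron_len N) = of_nat N - F 0 w N" by simp
      then show ?case using elim by (simp add: diff_divide_distrib)
    qed
    ultimately show ?thesis by (simp add: tendsto_cong)
  qed
  have "(\<lambda>N. e N * (F (s N) w N / of_nat N)) \<longlonglongrightarrow> 0"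
    using tendsto_norm_zero[OF F_annihilated[OF \<open>pair w = 0\<close> s_0]]
    by (intro tendsto_norm_zero_cancel[of "\<lambda>N. e N * _ N"]) (simp add: norm_mult norm_divide e_def)
  moreover have "(\<lambda>N. (e N * F (s N) h N - of_real (?x * perron_len N)) / of_nat N) \<longlonglongrightarrow> 0"
    using F_h_asymptotics[of t] by (simp add: s_def e_def)
  ultimately have "(\<lambda>N. of_real c * ((e N * F (s N) h N - of_real (?x * perron_len N)) / of_nat N)
      + of_real ?x * (of_real c * of_real (perron_len N) / of_nat N) + e N * (F (s N) w N / of_nat N))
    \<longlonglongrightarrow> of_real c * 0 + of_real ?x * 1 + 0"
    by (intro tendsto_intros cwlen)
  moreover have "of_real c * ((e N * F (s N) h N - of_real (?x * perron_len N)) / of_nat N)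
      + of_real ?x * (of_real c * of_real (perron_len N) / of_nat N) + e N * (F (s N) w N / of_nat N)
      = (\<Sum>n<N. cis (s N * (T n - m * log \<rho> (real N)))) / of_nat N" for N
  proof -
    have "(\<Sum>n<N. cis (s N * (T n - m * log \<rho> (real N)))) = e N * F (s N) (\<lambda>_. 1) N"
      unfolding F_def e_def sum_distrib_left
      by (intro sum.cong refl) (simp add: cis_mult algebra_simps)
    then show ?thesis
      unfolding F1 by (simp add: algebra_simps add_divide_distrib diff_divide_distrib)
  qed
  ultimately show ?thesis by simp
qed

end

section \<open>Martingale decomposition of Birkhoff sums\<close>

context substitution_fixed_point
begin

definition birkhoff_sum :: "('a \<Rightarrow> real) \<Rightarrow> nat \<Rightarrow> real" where
  "birkhoff_sum f n = word_sum f (stake n u)"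

lemma birkhoff_sum_image_len:
  assumes inv: "\<And>a. word_sum f (\<sigma> a) = f a"
    and "i \<le> length (\<sigma> (u !! j))"
  shows "birkhoff_sum f (image_len j + i) = birkhoff_sum f j + word_sum f (take i (\<sigma> (u !! j)))"
  using assms(2) by (simp add: birkhoff_sum_def stake_image_len word_sum_subst_word inv)

text \<open>
  The Poisson equation for \<open>x = g * h\<close> says exactly that the digits, corrected by \<open>g\<close> and \<open>m\<close>, have
  conditional mean zero, and a second Poisson equation provides \<open>k\<close>. For \<open>v = 0\<close> all digits vanish.
  Position 0 is its own parent, which forces \<open>m = 0\<close>, and then the corrected sum is constant along
  \<open>n, parent n, \<dots>, 0\<close>, hence everywhere.
\<close>

lemma martingale_decomposition:
  assumes inv: "\<And>a. word_sum f (\<sigma> a) = f a"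
    and unbounded: "\<not> bounded (range (birkhoff_sum f))"
  obtains g d m v k where
    "martingale_cocycle \<sigma> \<rho> h r u (\<lambda>n. birkhoff_sum f n + g (u !! n)) d m v k" "0 < v"
proof -
  define W where "W a = (\<Sum>i<length (\<sigma> a). word_sum f (take i (\<sigma> a)) * h (\<sigma> a ! i))" for a
  define m where "m = pair W / pair h / \<rho>"
  obtain x where x: "\<And>a. app x a - \<rho> * x a = pair W / pair h * h a - W a"
    using poisson_equation[of W] by blast
  define g where "g a = x a / h a" for a
  define d where "d a i = word_sum f (take i (\<sigma> a)) + g (\<sigma> a ! i) - g a - m" for a i
  have gh: "g a * h a = x a" for a
    using h_pos[of a] by (simp add: g_def)
  define V where "V a = (\<Sum>i<length (\<sigma> a). (d a i)\<^sup>2 * h (\<sigma> a ! i))" for a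
  obtain k where k: "\<And>a. app k a - \<rho> * k a = pair (\<lambda>a. V a / 2) / pair h * h a - V a / 2"
    using poisson_equation[of "\<lambda>a. V a / 2"] by blast
  define v where "v = pair V / pair h / \<rho>"
  have V_nonneg: "0 \<le> V a" for a
    unfolding V_def by (intro sum_nonneg) (auto simp: h_pos less_imp_le)
  have half: "pair (\<lambda>a. V a / 2) = pair V / 2"
    using pair_linear(3)[of "1 / 2" V] by simp
  have v_nonneg: "0 \<le> v"
    unfolding v_def using pair_h_pos rho_pos pair_mono[of "\<lambda>_. 0" V] V_nonneg by (simp add: pair_def)
  have step: "birkhoff_sum f (image_len j + i) + g (u !! (image_len j + i)) = birkhoff_sum f j + g (u !! j) + m + d (u !! j) i"
    if "i < length (\<sigma> (u !! j))" for i j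
    using that by (simp add: birkhoff_sum_image_len inv snth_image_len d_def)
  have "martingale_cocycle \<sigma> \<rho> h r u (\<lambda>n. birkhoff_sum f n + g (u !! n)) d m v k"
  proof
    show "(\<Sum>i<length (\<sigma> a). d a i * h (\<sigma> a ! i)) = 0" for a
    proof -
      have "(\<Sum>i<length (\<sigma> a). d a i * h (\<sigma> a ! i)) = W a + app x a - g a * app h a - m * app h a"
        by (simp add: d_def W_def app_eq_nth distrib_right left_diff_distrib sum.distrib
            sum_subtractf sum_distrib_left gh)
      also have "\<dots> = W a + (app x a - \<rho> * x a) - \<rho> * m * h a"
        using gh[of a] by (simp add: app_h algebra_simps)
      also have "\<dots> = 0"
        using rho_pos by (simp add: x m_def)
      finally show ?thesis .
    qed
    show "app k a - \<rho> * k a = \<rho> * v / 2 * h a - (\<Sum>i<length (\<sigma> a). (d a i)\<^sup>2 * h (\<sigma> a ! i)) / 2" for a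
      unfolding k V_def[symmetric] using rho_pos by (simp add: v_def half)
  qed (use step v_nonneg in auto)
  moreover have "0 < v"
  proof (rule ccontr)
    assume "\<not> 0 < v"
    then have "\<not> 0 < pair V" using pair_h_pos rho_pos by (auto simp: v_def zero_less_mult_iff divide_simps)
    then have "V a = 0" for a
      using pair_pos[of V a] V_nonneg by (metis less_le)
    then have d0: "d a i = 0" if "i < length (\<sigma> a)" for a i
      using that h_pos unfolding V_def
      by (subst (asm) sum_nonneg_eq_0_iff) (auto simp: less_imp_le less_imp_neq[symmetric])
    define T where "T n = birkhoff_sum f n + g (u !! n)" for n
    have T: "T n = T (parent n) + m" for n
    proof -
      obtain i where "i < length (\<sigma> (u !! parent n))" "n = image_len (parent n) + i"
        using obtain_parent[of n] by blast
      then show ?thesis using step[of i "parent n"] d0[of i "u !! parent n"] by (simp add: T_def)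
    qed
    have "m = 0" using T[of 0] parent_le[of 0] by simp
    have "T n = T 0" for n
    proof (induction n rule: less_induct)
      case (less n)
      show ?case
      proof (cases "n = 0")
        case False
        then have "T (parent n) = T 0" by (intro less parent_less) simp
        then show ?thesis using T[of n] \<open>m = 0\<close> by linarith
      qed simp
    qed
    then have eq: "birkhoff_sum f n = T 0 - g (u !! n)" for n
      by (metis T_def add_diff_cancel_right')
    have "range (birkhoff_sum f) \<subseteq> (\<lambda>a. T 0 - g a) ` UNIV"
      by (auto simp: eq)
    then have "bounded (range (birkhoff_sum f))"
      by (rule bounded_subset[rotated]) (simp add: finite_imp_bounded)
    with unbounded show False by simp
  qed
  ultimately show ?thesis by (rule that)
qed

text \<open>
  Removing the bounded correction \<open>g\<close> changes the phases by \<open>O(\<bar>s\<bar>)\<close>, and moving the range from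
  \<open>0, \<dots>, N - 1\<close> to \<open>1, \<dots>, N\<close> changes two terms.
\<close>

theorem birkhoff_sum_characteristic_function_limit:
  assumes inv: "\<And>a. word_sum f (\<sigma> a) = f a"
    and unbounded: "\<not> bounded (range (birkhoff_sum f))"
  shows "\<exists>m v. 0 < v \<and>
    (\<forall>t. (\<lambda>N. (\<Sum>n\<in>{1..N}. cis (t / sqrt (log \<rho> (real N)) * (birkhoff_sum f n - m * log \<rho> (real N)))) / of_nat N)
      \<longlonglongrightarrow> of_real (exp (- (v * t\<^sup>2 / 2))))"
proof -
  obtain g d m v k where M: "martingale_cocycle \<sigma> \<rho> h r u (\<lambda>n. birkhoff_sum f n + g (u !! n)) d m v k"
    and v: "0 < v"
    using martingale_decomposition[OF inv unbounded] by blast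
  interpret martingale_cocycle \<sigma> \<rho> h r u "\<lambda>n. birkhoff_sum f n + g (u !! n)" d m v k
    by (rule M)
  define G where "G = (\<Sum>a\<in>UNIV. \<bar>g a\<bar>)"
  have G: "\<bar>g a\<bar> \<le> G" for a unfolding G_def by (rule member_le_sum) auto
  have "(\<lambda>N. (\<Sum>n\<in>{1..N}. cis (t / sqrt (log \<rho> (real N)) * (birkhoff_sum f n - m * log \<rho> (real N)))) / of_nat N)
      \<longlonglongrightarrow> of_real (exp (- (v * t\<^sup>2 / 2)))" for t
  proof -
    define s where "s N = t / sqrt (log \<rho> (real N))" for N
    define x where "x N n = s N * (birkhoff_sum f n + g (u !! n) - m * log \<rho> (real N))" for N n
    define y where "y N n = s N * (birkhoff_sum f n - m * log \<rho> (real N))" for N n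
    have "filterlim (\<lambda>N. log \<rho> (real N)) at_top sequentially"
      using rho_gt_1 by real_asymp
    then have s_0: "s \<longlonglongrightarrow> 0"
      unfolding s_def
      by (intro tendsto_divide_0[OF tendsto_const] filterlim_at_top_imp_at_infinity
            filterlim_compose[OF sqrt_at_top])
    have lim: "(\<lambda>N. (\<Sum>n<N. cis (x N n)) / of_nat N) \<longlonglongrightarrow> of_real (exp (- (v * t\<^sup>2 / 2)))"
      using characteristic_function_limit[of t] by (simp add: x_def s_def)
    have "(\<lambda>N. (\<Sum>n\<in>{1..N}. cis (y N n)) / of_nat N - (\<Sum>n<N. cis (x N n)) / of_nat N) \<longlonglongrightarrow> 0"
    proof (rule Lim_null_comparison)
      show "(\<lambda>N. \<bar>s N\<bar> * G + 2 * (1 / real N)) \<longlonglongrightarrow> 0"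
        using tendsto_add[OF tendsto_mult_left_zero[OF tendsto_rabs_zero[OF s_0], of G]
            tendsto_mult_right_zero[OF lim_1_over_n, of 2]] by simp
      show "\<forall>\<^sub>F N in sequentially. norm ((\<Sum>n\<in>{1..N}. cis (y N n)) / of_nat N - (\<Sum>n<N. cis (x N n)) / of_nat N)
          \<le> \<bar>s N\<bar> * G + 2 * (1 / real N)"
        using eventually_gt_at_top[of 0]
      proof eventually_elim
        case (elim N)
        have "(\<Sum>n\<in>{1..M}. cis (y N n)) = (\<Sum>n<M. cis (y N n)) + cis (y N M) - cis (y N 0)" for M
          by (induction M) simp_all
        then have "(\<Sum>n\<in>{1..N}. cis (y N n)) - (\<Sum>n<N. cis (x N n))
            = (\<Sum>n<N. cis (y N n) - cis (x N n)) + (cis (y N N) - cis (y N 0))"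
          by (simp add: sum_subtractf)
        also have "cmod \<dots> \<le> real N * (\<bar>s N\<bar> * G) + 2"
        proof (rule norm_triangle_mono)
          have "cmod (cis (y N n) - cis (x N n)) \<le> \<bar>s N\<bar> * G" for n
          proof -
            have "cis (y N n) - cis (x N n) = cis (x N n) * (cis (y N n - x N n) - 1)"
              by (simp add: right_diff_distrib cis_mult)
            then have "cmod (cis (y N n) - cis (x N n)) \<le> \<bar>y N n - x N n\<bar>"
              using cis_approx1 by (simp add: norm_mult)
            also have "\<dots> = \<bar>s N\<bar> * \<bar>g (u !! n)\<bar>"
              by (simp add: x_def y_def flip: abs_mult) (simp add: algebra_simps)
            also have "\<dots> \<le> \<bar>s N\<bar> * G" by (intro mult_left_mono G) simp
            finally show ?thesis .
          qed
          then show "cmod (\<Sum>n<N. cis (y N n) - cis (x N n)) \<le> real N * (\<bar>s N\<bar> * G)"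
            by (intro order_trans[OF sum_norm_le[where g = "\<lambda>_. \<bar>s N\<bar> * G"]]) auto
          show "cmod (cis (y N N) - cis (y N 0)) \<le> 2"
            using norm_triangle_ineq4[of "cis (y N N)" "cis (y N 0)"] by simp
        qed
        finally show ?case
          using elim by (simp add: norm_divide field_simps flip: diff_divide_distrib)
      qed
    qed
    from tendsto_add[OF this lim] show ?thesis by (simp add: y_def s_def)
  qed
  with v show ?thesis by blast
qed

end

section \<open>From characteristic functions to frequencies\<close>

text \<open>
  The averages of exponentials are the characteristic functions of the empirical measures on
  \<open>X N 1, \<dots>, X N N\<close>, and the normal distribution has no atoms, so weak convergence yields
  convergence of the distribution functions at every point.
\<close>

lemma gaussian_limit_of_frequencies:
  fixes X :: "nat \<Rightarrow> nat \<Rightarrow> real"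
  assumes X: "\<And>t. (\<lambda>N. (\<Sum>n\<in>{1..N}. cis (t * X N n)) / of_nat N) \<longlonglongrightarrow> of_real (exp (- (t\<^sup>2) / 2))"
  shows "(\<lambda>N. 1 / real N * real (card {n. 1 \<le> n \<and> n \<le> N \<and> X N n \<le> x}))
    \<longlonglongrightarrow> (LBINT x:{..x}. exp (- (x^2) / 2) / sqrt (2 * pi))"
proof -
  \<comment> \<open>\<open>Suc N\<close>, as the uniform distribution needs a nonempty range.\<close>
  define \<mu> where "\<mu> N = distr (measure_pmf (pmf_of_set {1..Suc N})) borel (X (Suc N))" for N
  have \<mu>: "real_distribution (\<mu> N)" for N
    unfolding \<mu>_def by (intro prob_space.real_distribution_distr prob_space_measure_pmf) simp
  have ne: "{1..Suc N} \<noteq> {}" for N by simp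
  have char: "char (\<mu> N) t = (\<Sum>n\<in>{1..Suc N}. cis (t * X (Suc N) n)) / of_nat (Suc N)" for N t
  proof -
    have "char (\<mu> N) t = (CLINT n|measure_pmf (pmf_of_set {1..Suc N}). cis (t * X (Suc N) n))"
      unfolding char_def \<mu>_def by (subst integral_distr) (auto simp: cis_conv_exp)
    also have "\<dots> = (\<Sum>n\<in>{1..Suc N}. pmf (pmf_of_set {1..Suc N}) n *\<^sub>R cis (t * X (Suc N) n))"
      by (rule integral_measure_pmf[of "{1..Suc N}"]) (simp_all add: set_pmf_of_set[OF ne])
    also have "\<dots> = (\<Sum>n\<in>{1..Suc N}. cis (t * X (Suc N) n) / of_nat (Suc N))"
      by (intro sum.cong refl) (simp add: pmf_of_set[OF ne] scaleR_conv_of_real del: of_nat_Suc)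
    finally show ?thesis by (simp only: sum_divide_distrib)
  qed
  have "weak_conv_m \<mu> std_normal_distribution"
  proof (rule levy_continuity[OF \<mu> real_dist_normal_dist])
    show "(\<lambda>N. char (\<mu> N) t) \<longlonglongrightarrow> char std_normal_distribution t" for t
      unfolding char char_std_normal_distribution by (rule LIMSEQ_Suc[OF X])
  qed
  moreover interpret std: real_distribution std_normal_distribution
    by (rule real_dist_normal_dist)
  have "measure std_normal_distribution {x} = 0"
  proof -
    have "emeasure std_normal_distribution {x} = 0"
      by (subst emeasure_density) (auto intro!: nn_integral_null_set)
    then show ?thesis by (simp add: measure_def)
  qed
  then have "isCont (cdf std_normal_distribution) x"
    by (simp add: std.isCont_cdf)
  ultimately have lim: "(\<lambda>N. cdf (\<mu> N) x) \<longlonglongrightarrow> cdf std_normal_distribution x"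
    by (simp add: weak_conv_m_def weak_conv_def)
  have cdf_\<mu>: "cdf (\<mu> N) x = 1 / real (Suc N) * real (card {n. 1 \<le> n \<and> n \<le> Suc N \<and> X (Suc N) n \<le> x})" for N
  proof -
    have "cdf (\<mu> N) x = measure (measure_pmf (pmf_of_set {1..Suc N})) {n. X (Suc N) n \<le> x}"
      unfolding cdf_def \<mu>_def by (subst measure_distr) (auto simp: vimage_def)
    also have "\<dots> = card ({1..Suc N} \<inter> {n. X (Suc N) n \<le> x}) / card {1..Suc N}"
      by (rule measure_pmf_of_set[OF ne]) simp
    also have "{1..Suc N} \<inter> {n. X (Suc N) n \<le> x} = {n. 1 \<le> n \<and> n \<le> Suc N \<and> X (Suc N) n \<le> x}"
      by auto
    finally show ?thesis by simp
  qed
  have cdf_std: "cdf std_normal_distribution x = (LBINT x:{..x}. exp (- (x^2) / 2) / sqrt (2 * pi))"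
  proof -
    have "cdf std_normal_distribution x = (LINT y|std_normal_distribution. indicator {..x} y)"
      by (simp add: cdf_def)
    also have "\<dots> = (LINT y|lborel. std_normal_density y * indicator {..x} y)"
      by (subst integral_real_density) auto
    also have "\<dots> = (LBINT x:{..x}. exp (- (x^2) / 2) / sqrt (2 * pi))"
      unfolding set_lebesgue_integral_def
      by (intro Bochner_Integration.integral_cong) (auto simp: std_normal_density_def)
    finally show ?thesis .
  qed
  show ?thesis
    by (rule LIMSEQ_imp_Suc) (rule lim[unfolded cdf_\<mu> cdf_std])
qed

section \<open>The central limit theorem for substitution sequences\<close>

theorem theorem1p2:
  fixes \<theta> :: "'a::finite \<Rightarrow> 'a list"
    and lam :: real
    and u :: "'a stream"
    and f :: "'a \<Rightarrow> real"
  assumes "primitive_subst \<theta>"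
    and "perron_frobenius_eigenvalue (subst_matrix \<theta>) lam"
    and "lam > 1"
    and "fixed_point_subst \<theta> u"
    and "left_eigenfunction (subst_matrix \<theta>) 1 f"
    and "\<not> coboundary u f"
  shows "\<exists>c1 c2 :: real. c2 \<noteq> 0 \<and>
    (\<forall>t::real.
      (\<lambda>N::nat. 1 / real N *
         real (card {n::nat. 1 \<le> n \<and> n \<le> N \<and>
           (word_sum f (stake n u) - c1 * log lam (real N)) /
             (c2 * sqrt (log lam (real N))) \<le> t}))
      \<longlonglongrightarrow> (LBINT x:{..t}. exp (- (x^2) / 2) / sqrt (2 * pi)))"
proof -
  obtain p where p: "0 < p" "(subst_seq \<theta> ^^ p) u = u"
    using assms(4) by (auto simp: fixed_point_subst_def)
  obtain K where K: "0 < K" "p dvd K" "\<And>a b. 0 < count_list ((subst_word \<theta> ^^ K) [a]) b"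
    using primitive_subst_positive_power[OF assms(1) p(1)] by blast
  define \<sigma> where "\<sigma> a = (subst_word \<theta> ^^ K) [a]" for a
  have \<sigma>: "(subst_word \<theta> ^^ K) w = subst_word \<sigma> w" for w
    unfolding \<sigma>_def by (rule subst_word_funpow)
  obtain \<rho> h r where PM: "positive_matrix (\<lambda>a b. real (count_list (\<sigma> a) b)) \<rho> h r"
    using positive_matrix_exists[of "\<lambda>a b. real (count_list (\<sigma> a) b)"] K(3) by (auto simp: \<sigma>_def)
  interpret positive_matrix "\<lambda>a b. real (count_list (\<sigma> a) b)" \<rho> h r
    by (rule PM)
  have "1 < \<rho>"
  proof -
    obtain x where x: "x \<noteq> 0" "subst_matrix \<theta> *v x = lam *s x"
      using assms(2) by (auto simp: perron_frobenius_eigenvalue_def matrix_eigenvalue_def)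
    obtain c where "x $ c \<noteq> 0" using x(1) by (auto simp: vec_eq_iff)
    then have "lam ^ K \<le> \<rho>"
    proof (rule eigenvalue_le_rho)
      show "(\<Sum>a\<in>UNIV. real (count_list (\<sigma> a) b) * x $ a) = lam ^ K * x $ b" for b
        using arg_cong[OF matrix_power_eigenvector[OF x(2), of K], of "\<lambda>v. v $ b"]
        by (simp add: matrix_vector_mult_def matrix_power_subst_matrix \<sigma>_def)
    qed
    moreover have "1 < lam ^ K" using assms(3) K(1) by simp
    ultimately show ?thesis by simp
  qed
  have \<theta>_ne: "\<theta> a \<noteq> []" for a
  proof
    assume "\<theta> a = []"
    have "(subst_word \<theta> ^^ n) [] = []" for n by (induction n) auto
    then have "(subst_word \<theta> ^^ K) [a] = []"
      using \<open>\<theta> a = []\<close> K(1) by (cases K) (simp_all add: funpow_Suc_right del: funpow.simps)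
    then show False using K(3)[of a a] by simp
  qed
  have uK: "(subst_seq \<theta> ^^ K) u = u"
  proof -
    obtain n where "K = p * n" using K(2) by blast
    moreover have "((subst_seq \<theta> ^^ p) ^^ n) u = u" by (induction n) (simp_all add: p(2))
    ultimately show ?thesis by (simp add: funpow_mult)
  qed
  interpret substitution_fixed_point \<sigma> \<rho> h r u
  proof
    show "stake (length (subst_word \<sigma> (stake m u))) u = subst_word \<sigma> (stake m u)" for m
      using stake_subst_seq_funpow_fixed[OF \<theta>_ne uK, of m] by (simp add: \<sigma>)
  qed (rule \<open>1 < \<rho>\<close>)
  have "word_sum f (\<theta> b) = f b" for b
    using assms(5) by (simp add: left_eigenfunction_def subst_matrix_def word_sum_eq_count mult.commute)
  then have inv: "word_sum f (\<sigma> a) = f a" for a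
    unfolding \<sigma>_def by (simp add: word_sum_subst_word_funpow)
  have "\<not> bounded (range (birkhoff_sum f))"
    using assms(6) unfolding coboundary_def birkhoff_sum_def
    by (rule contrapos_nn) (auto elim!: bounded_subset)
  then obtain m v where v: "0 < v" and lim:
    "\<And>t. (\<lambda>N. (\<Sum>n\<in>{1..N}. cis (t / sqrt (log \<rho> (real N)) * (birkhoff_sum f n - m * log \<rho> (real N)))) / of_nat N)
      \<longlonglongrightarrow> of_real (exp (- (v * t\<^sup>2 / 2)))"
    using birkhoff_sum_characteristic_function_limit[of f, OF inv] by blast
  \<comment> \<open>The factor that converts \<open>log lam\<close> into \<open>log \<rho>\<close> is absorbed into the constants.\<close>
  define \<kappa> where "\<kappa> = ln lam / ln \<rho>"
  have \<kappa>: "0 < \<kappa>" using \<open>1 < \<rho>\<close> assms(3) by (simp add: \<kappa>_def)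
  have log: "log \<rho> x = \<kappa> * log lam x" for x
    using assms(3) by (simp add: \<kappa>_def log_def)
  have "(\<lambda>N. 1 / real N * real (card {n. 1 \<le> n \<and> n \<le> N \<and>
           (word_sum f (stake n u) - m * \<kappa> * log lam (real N)) /
             (sqrt (v * \<kappa>) * sqrt (log lam (real N))) \<le> t}))
      \<longlonglongrightarrow> (LBINT x:{..t}. exp (- (x^2) / 2) / sqrt (2 * pi))" for t
  proof (rule gaussian_limit_of_frequencies)
    fix s :: real
    have "v * (s / sqrt v)\<^sup>2 / 2 = s\<^sup>2 / 2"
      using v by (simp add: power_divide)
    moreover have "s / sqrt v / sqrt (log \<rho> (real N)) * (birkhoff_sum f n - m * log \<rho> (real N))
        = s * ((word_sum f (stake n u) - m * \<kappa> * log lam (real N)) / (sqrt (v * \<kappa>) * sqrt (log lam (real N))))" for n N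
      by (simp add: log birkhoff_sum_def real_sqrt_mult mult.assoc)
    ultimately show "(\<lambda>N. (\<Sum>n\<in>{1..N}. cis (s * ((word_sum f (stake n u) - m * \<kappa> * log lam (real N)) /
        (sqrt (v * \<kappa>) * sqrt (log lam (real N)))))) / of_nat N) \<longlonglongrightarrow> of_real (exp (- s\<^sup>2 / 2))"
      using lim[of "s / sqrt v"] by simp
  qed
  moreover have "sqrt (v * \<kappa>) \<noteq> 0" using v \<kappa> by simp
  ultimately show ?thesis by blast
qed

end
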